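(* Let $n>1$ be a natural number, $H_n$ Houghton's group acting on $S=\mathbb{N}\times\{1,\dots,n\}$, $q\in H_n$ and $Q=\langle q\rangle$. 1. If $q$ has finite order then $$C_{H_n}(q)\cong H_n|_{S^Q}\times C_1\times\cdots\times C_t,$$ where $H_n|_{S^Q}\cong H_n$ is Houghton's group restricted to $S^Q$ and, for all $a\in\{1,\dots,t\}$, $C_a\cong W_QQ_a\wr\mathrm{Sym}_r$ for $Q_a$ an isotropy group (in $Q$) of a point of $S_a$ and $r=|S_a|/|Q:Q_a|$. In particular $H_n$ is (isomorphic to) a finite index subgroup of $C_{H_n}(q)$. 2. If $q$ has infinite order then either $$C_{H_n}(q)\cong H_k\times\mathbb{Z}^r\times C_1\times\cdots\times C_t\quad\text{or}\quad C_{H_n}(q)\cong F\times\mathbb{Z}^r\times C_1\times\cdots\times C_t,$$ where $F$ is some finite symmetric group, $H_k$ is Houghton's group with $0\le k\le n-2$, and the groups $C_a$ are as in part 1 (for the corresponding sets $S_a$, with the integer $|S_a|/|Q:Q_a|$ as degree of the symmetric group). In the first case $1\le r\le\lfloor(n-k)/2\rfloor$, and in the second case $1\le r\le\lfloor n/2\rfloor$.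
   Context: For $k\ge1$, Houghton's group $H_k$ is the group of all permutations $h$ of $\mathbb{N}\times\{1,\dots,k\}$ for which there are $(z_1,\dots,z_k)\in\mathbb{N}^k$ and $(m_1,\dots,m_k)\in\mathbb{Z}^k$ with $h(i,x)=(i+m_x,x)$ for all $x$ and all $i\ge z_x$ ($H_0$ is trivial). $S^Q$ is the set of points of $S$ fixed by $Q$. $H_n|_{S^Q}$ is the group of permutations in $H_n$ that fix $S\setminus S^Q$ pointwise. $S\setminus S^Q$ is partitioned according to the $Q$-conjugacy class of the stabiliser $Q_s$ of a point $s$. If $q$ has finite order, $S_1,\dots,S_t$ are all the (finite) parts of $S\setminus S^Q$. If $q$ has infinite order, $S_1,\dots,S_t$ are the (finite) parts whose stabilisers are nontrivial, i.e. neither trivial nor equal to $Q$. $W_QQ_a=N_QQ_a/Q_a$ is the Weyl group. $A\wr\mathrm{Sym}_r=A^r\rtimes\mathrm{Sym}_r$ is the wreath product with $\mathrm{Sym}_r$ permuting the factors. Finite symmetric groups may be trivial. *)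

theory Defs
  imports "HOL-Algebra.Algebra"
begin

section \<open>Houghton's groups\<close>

definition rays :: "nat \<Rightarrow> (nat \<times> nat) set" where
  "rays k = UNIV \<times> {1..k}"

text \<open>As for \<^const>\<open>sym_group\<close>, a permutation of \<^term>\<open>rays k\<close> is extended by the identity to the
  whole type. The last condition is stated over the integers so that \<open>i + m x\<close> is never truncated.\<close>

definition houghton :: "nat \<Rightarrow> (nat \<times> nat \<Rightarrow> nat \<times> nat) monoid" where
  "houghton k =
     \<lparr> carrier = {h. h permutes rays k \<and>
         (\<exists>(z :: nat \<Rightarrow> nat) (m :: nat \<Rightarrow> int). \<forall>x\<in>{1..k}. \<forall>i\<ge>z x.
            int (fst (h (i, x))) = int i + m x \<and> snd (h (i, x)) = x)},
       monoid.mult = (\<circ>), one = id \<rparr>"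

definition houghton_on :: "nat \<Rightarrow> (nat \<times> nat) set \<Rightarrow> (nat \<times> nat \<Rightarrow> nat \<times> nat) monoid" where
  "houghton_on n T =
     (houghton n) \<lparr> carrier := {h \<in> carrier (houghton n). \<forall>s \<in> rays n - T. h s = s} \<rparr>"


section \<open>General group-theoretic notions\<close>

definition centralizer :: "('a, 'b) monoid_scheme \<Rightarrow> 'a \<Rightarrow> ('a, 'b) monoid_scheme" where
  "centralizer G q = G \<lparr> carrier := {g \<in> carrier G. g \<otimes>\<^bsub>G\<^esub> q = q \<otimes>\<^bsub>G\<^esub> g} \<rparr>"

definition Weyl_group :: "('a, 'b) monoid_scheme \<Rightarrow> 'a set \<Rightarrow> 'a set monoid" where
  "Weyl_group G K = (G \<lparr> carrier := normalizer G K \<rparr>) Mod K"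

definition subgroup_index :: "('a, 'b) monoid_scheme \<Rightarrow> 'a set \<Rightarrow> nat" where
  "subgroup_index G K = card (rcosets\<^bsub>G\<^esub> K)"

definition semidirect_product ::
    "('a, 'b) monoid_scheme \<Rightarrow> ('c, 'd) monoid_scheme \<Rightarrow> ('c \<Rightarrow> 'a \<Rightarrow> 'a) \<Rightarrow> ('a \<times> 'c) monoid" where
  "semidirect_product N G \<phi> =
     \<lparr> carrier = carrier N \<times> carrier G,
       monoid.mult = (\<lambda>(a, g) (b, h). (a \<otimes>\<^bsub>N\<^esub> \<phi> g b, g \<otimes>\<^bsub>G\<^esub> h)),
       one = (\<one>\<^bsub>N\<^esub>, \<one>\<^bsub>G\<^esub>) \<rparr>"

text \<open>Permuting coordinates by the inverse makes this a left action of the symmetric group.\<close>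

definition wreath_sym ::
    "('a, 'b) monoid_scheme \<Rightarrow> nat \<Rightarrow> ((nat \<Rightarrow> 'a) \<times> (nat \<Rightarrow> nat)) monoid" where
  "wreath_sym A r =
     semidirect_product (product_group {1..r} (\<lambda>_. A)) (sym_group r)
       (\<lambda>\<sigma> f. \<lambda>i\<in>{1..r}. f (inv_into UNIV \<sigma> i))"


section \<open>The action of a cyclic subgroup\<close>

definition cyc :: "nat \<Rightarrow> (nat \<times> nat \<Rightarrow> nat \<times> nat) \<Rightarrow> (nat \<times> nat \<Rightarrow> nat \<times> nat) monoid" where
  "cyc n q = subgroup_generated (houghton n) {q}"

definition fixed_points :: "nat \<Rightarrow> (nat \<times> nat \<Rightarrow> nat \<times> nat) \<Rightarrow> (nat \<times> nat) set" where
  "fixed_points n q = {s \<in> rays n. \<forall>g \<in> carrier (cyc n q). g s = s}"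

abbreviation stab ::
    "nat \<Rightarrow> (nat \<times> nat \<Rightarrow> nat \<times> nat) \<Rightarrow> nat \<times> nat \<Rightarrow> (nat \<times> nat \<Rightarrow> nat \<times> nat) set" where
  "stab n q s \<equiv> stabilizer (cyc n q) (\<lambda>g. g) s"

definition stab_parts :: "nat \<Rightarrow> (nat \<times> nat \<Rightarrow> nat \<times> nat) \<Rightarrow> (nat \<times> nat) set set" where
  "stab_parts n q =
     (rays n - fixed_points n q) //
       {(s, s'). s \<in> rays n - fixed_points n q \<and> s' \<in> rays n - fixed_points n q \<and>
          (\<exists>g \<in> carrier (cyc n q).
             stab n q s' = g <#\<^bsub>cyc n q\<^esub> stab n q s #>\<^bsub>cyc n q\<^esub> inv\<^bsub>cyc n q\<^esub> g)}"

definition nontrivial_stab_parts :: "nat \<Rightarrow> (nat \<times> nat \<Rightarrow> nat \<times> nat) \<Rightarrow> (nat \<times> nat) set set" where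
  "nontrivial_stab_parts n q =
     {P \<in> stab_parts n q. \<forall>s\<in>P. stab n q s \<noteq> {\<one>\<^bsub>cyc n q\<^esub>} \<and> stab n q s \<noteq> carrier (cyc n q)}"

text \<open>For a part \<open>P\<close> and a chosen point \<open>s\<close> of it, this is the wreath product of the Weyl group of the
  isotropy group of \<open>s\<close> with the symmetric group of degree \<open>|P| / |Q : Q\<^sub>s|\<close>; the main statement
  asserts that this quotient is exact.\<close>

definition part_group :: "nat \<Rightarrow> (nat \<times> nat \<Rightarrow> nat \<times> nat) \<Rightarrow> (nat \<times> nat) set \<Rightarrow> nat \<times> nat \<Rightarrow>
    ((nat \<Rightarrow> (nat \<times> nat \<Rightarrow> nat \<times> nat) set) \<times> (nat \<Rightarrow> nat)) monoid" where
  "part_group n q P s =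
     wreath_sym (Weyl_group (cyc n q) (stab n q s))
       (card P div subgroup_index (cyc n q) (stab n q s))"

end

theory Submission
  imports Defs
begin

text \<open>Elements of \<open>H\<^sub>n\<close> translate a tail of every ray, so on a tail \<open>q\<close> either is the identity or has
  infinite orbits only. Hence \<open>S\<close> splits into the fixed points, finitely many further periodic points
  and the aperiodic points, and on each ray almost all points lie in one of these. The centraliser \<open>C\<close>
  preserves this splitting and is the product of its restrictions to the three pieces. On the fixed
  points it consists of all elements of \<open>H\<^sub>n\<close> supported there, which a bijection that is eventually a
  translation on each ray identifies with \<open>H\<^sub>k\<close>, or with a finite symmetric group. Among the
  periodic points those with a given stabiliser \<open>Q\<^sub>a\<close> form a free \<open>Q/Q\<^sub>a\<close>-set with finitely many orbits,
  whose automorphism group is a wreath product.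

  For the aperiodic points, call a \<open>q\<close>-invariant subset admissible if it contains almost all or almost
  none of every ray. An admissible set is determined by the rays it contains almost entirely, and \<open>C\<close>
  preserves those rays, hence every admissible set. On a minimal admissible set an element of \<open>C\<close> is
  determined by its translation length on one of its rays, because its fixed points are again
  admissible; so \<open>C\<close> restricts to an infinite cyclic group there. A counting argument shows that a
  nonempty admissible set contains at least two rays almost entirely, which bounds the number \<open>r\<close> of
  minimal ones.\<close>

section \<open>Preliminaries on groups\<close>

text \<open>Cutting an element of C down to an invariant set must again give an eventual translation
  on every ray. This rules out single infinite orbits as pieces: if q translates a ray by 2, an
  orbit running into that ray takes only every second point of its tail. Hence the restriction to
  sets containing almost all or almost none of each ray. The minimal ones, and not the orbits, index
  the factors of Z^r, and an element of C acting there, say by a translation by 1, need not come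
  from a power of q. Minimal sets occupy disjoint sets of rays, at least two each, while k counts
  the rays on which q is eventually the identity; therefore 2r <= n - k. The symmetric group F
  arises when there are no rays of the latter kind. Since Q is abelian, conjugate stabilisers are
  equal and every element of Q normalises Q_a. So a part is the set of points with one common
  stabiliser, and its Weyl group is Q/Q_a.\<close>

lemma (in comm_group) conjugate_coset_eq:
  assumes "K \<subseteq> carrier G" "g \<in> carrier G"
  shows "g <# K #> inv g = K"
proof -
  have "g <# K = K #> g"
    using assms m_comm unfolding l_coset_def r_coset_def by (intro SUP_cong) auto
  then show ?thesis
    using assms coset_mult_assoc[OF assms(1) _ inv_closed] by simp
qed

text \<open>Closure of the source under multiplication suffices to invert the isomorphism. This is
  applied to a wreath product, where checking the group axioms is thereby avoided.\<close>

lemma iso_sym_closed: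
  assumes iso: "G \<cong> H" and G: "\<And>x y. x \<in> carrier G \<Longrightarrow> y \<in> carrier G \<Longrightarrow> x \<otimes>\<^bsub>G\<^esub> y \<in> carrier G"
  shows "H \<cong> G"
proof -
  obtain f where f: "f \<in> hom G H" "bij_betw f (carrier G) (carrier H)"
    using iso by (auto simp: is_iso_def iso_def)
  let ?g = "inv_into (carrier G) f"
  note g = bij_betw_inv_into[OF f(2)]
  have "?g \<in> hom H G"
  proof (rule homI)
    fix x y assume xy: "x \<in> carrier H" "y \<in> carrier H"
    then have c: "?g x \<in> carrier G" "?g y \<in> carrier G"
      using g by (auto dest: bij_betw_apply)
    then have "f (?g x \<otimes>\<^bsub>G\<^esub> ?g y) = x \<otimes>\<^bsub>H\<^esub> y"
      using xy by (simp add: hom_mult[OF f(1)] bij_betw_inv_into_right[OF f(2)])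
    then show "?g (x \<otimes>\<^bsub>H\<^esub> y) = ?g x \<otimes>\<^bsub>G\<^esub> ?g y"
      using G[OF c] bij_betw_inv_into_left[OF f(2)] by metis
  qed (use g in \<open>auto dest: bij_betw_apply\<close>)
  then show ?thesis
    using g by (auto simp: is_iso_def iso_def)
qed

text \<open>Only the factors on the left are required to be groups; on the right will stand wreath
  products, whose group axioms are not established here.\<close>

lemma product_group_iso:
  assumes iso: "\<And>i. i \<in> I \<Longrightarrow> G i \<cong> H i" and G: "\<And>i. i \<in> I \<Longrightarrow> group (G i)"
  shows "product_group I G \<cong> product_group I H"
proof -
  have "\<exists>f. f \<in> hom (G i) (H i) \<and> bij_betw f (carrier (G i)) (carrier (H i))" if "i \<in> I" for i
    using iso[OF that] by (auto simp: is_iso_def iso_def)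
  then obtain f where hom: "\<And>i. i \<in> I \<Longrightarrow> f i \<in> hom (G i) (H i)"
    and bij: "\<And>i. i \<in> I \<Longrightarrow> bij_betw (f i) (carrier (G i)) (carrier (H i))"
    by metis
  let ?f = "\<lambda>x. \<lambda>i\<in>I. f i (x i)" and ?g = "\<lambda>x. \<lambda>i\<in>I. inv_into (carrier (G i)) (f i) (x i)"
  show ?thesis
  proof (rule is_isoI, rule isoI)
    show "?f \<in> hom (product_group I G) (product_group I H)"
      by (rule homI) (auto simp: PiE_iff hom_in_carrier[OF hom] hom_mult[OF hom] fun_eq_iff)
    show "bij_betw ?f (carrier (product_group I G)) (carrier (product_group I H))"
    proof (rule bij_betw_byWitness[where f' = ?g])
      show "\<forall>x\<in>carrier (product_group I G). ?g (?f x) = x"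
        by (simp add: PiE_iff bij_betw_inv_into_left[OF bij] extensional_def fun_eq_iff)
      show "\<forall>x\<in>carrier (product_group I H). ?f (?g x) = x"
        by (simp add: PiE_iff bij_betw_inv_into_right[OF bij] extensional_def fun_eq_iff)
    qed (auto simp: PiE_iff bij_betw_apply[OF bij] bij_betw_apply[OF bij_betw_inv_into[OF bij]])
  qed
qed

text \<open>The image of \<phi> is a nonzero subgroup of the integers, hence consists of the
  multiples of its least positive element d; \<phi> divided by d is the isomorphism.\<close>

lemma iso_integer_group:
  assumes G: "group G" and \<phi>: "\<phi> \<in> hom G integer_group" "inj_on \<phi> (carrier G)"
    and nz: "g0 \<in> carrier G" "\<phi> g0 \<noteq> 0"
  shows "G \<cong> integer_group"
proof -
  interpret group G by (rule G)
  interpret group_hom G integer_group \<phi>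
    using \<phi>(1) G by (simp add: group_hom_def group_hom_axioms_def)
  define I where "I = \<phi> ` carrier G"
  have add: "u + v \<in> I" if uv: "u \<in> I" "v \<in> I" for u v
  proof -
    obtain g h where "g \<in> carrier G" "u = \<phi> g" "h \<in> carrier G" "v = \<phi> h"
      using uv by (auto simp: I_def)
    then show ?thesis
      unfolding I_def by (intro image_eqI[of _ _ "g \<otimes>\<^bsub>G\<^esub> h"]) simp_all
  qed
  have uminus: "- u \<in> I" if u: "u \<in> I" for u
  proof -
    obtain g where "g \<in> carrier G" "u = \<phi> g"
      using u by (auto simp: I_def)
    then show ?thesis
      unfolding I_def by (intro image_eqI[of _ _ "inv\<^bsub>G\<^esub> g"]) simp_all
  qed
  have zero: "0 \<in> I"
    unfolding I_def by (intro image_eqI[of _ _ "\<one>\<^bsub>G\<^esub>"]) simp_all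
  have mult: "u * k \<in> I" if "u \<in> I" for u k :: int
  proof (induction k rule: int_induct[where k = 0])
    case (step1 i)
    then show ?case using add[OF _ that] by (simp add: distrib_left)
  next
    case (step2 i)
    then show ?case using add[OF _ uminus[OF that]] by (simp add: right_diff_distrib)
  qed (simp add: zero)
  have "\<bar>\<phi> g0\<bar> \<in> I"
    using nz uminus unfolding I_def by (simp add: abs_if)
  then have ex: "\<exists>m>0. int m \<in> I"
    using nz(2) by (intro exI[of _ "nat \<bar>\<phi> g0\<bar>"]) simp
  define d where "d = (LEAST m. m > 0 \<and> int m \<in> I)"
  have d: "d > 0" "int d \<in> I"
    using LeastI_ex[OF ex] by (simp_all add: d_def)
  have dvd: "int d dvd u" if "u \<in> I" for u
  proof (rule ccontr)
    assume "\<not> int d dvd u"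
    then have "u mod int d \<noteq> 0" by (simp add: mod_eq_0_iff_dvd)
    moreover have "u mod int d \<ge> 0" "u mod int d < int d" using d by simp_all
    ultimately have m: "u mod int d > 0" "u mod int d < int d" by linarith+
    have "u + - (int d * (u div int d)) \<in> I"
      using that d mult uminus add by blast
    moreover have "u + - (int d * (u div int d)) = u mod int d"
      by (simp add: minus_mult_div_eq_mod)
    ultimately have "int (nat (u mod int d)) \<in> I" using m by simp
    then have "(LEAST m. m > 0 \<and> int m \<in> I) \<le> nat (u mod int d)"
      using m by (intro Least_le) simp
    then have "d \<le> nat (u mod int d)"
      by (simp only: d_def[symmetric])
    then show False using m by simp
  qed
  define \<psi> where "\<psi> = (\<lambda>g. \<phi> g div int d)"
  have \<phi>\<psi>: "\<phi> g = int d * \<psi> g" if "g \<in> carrier G" for g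
    using dvd[of "\<phi> g"] that by (simp add: \<psi>_def I_def)
  have "\<psi> \<in> hom G integer_group"
  proof (rule homI)
    fix g h assume gh: "g \<in> carrier G" "h \<in> carrier G"
    have "int d * \<psi> (g \<otimes>\<^bsub>G\<^esub> h) = int d * (\<psi> g + \<psi> h)"
      using gh \<phi>\<psi> hom_mult[OF gh] by (simp add: distrib_left)
    then show "\<psi> (g \<otimes>\<^bsub>G\<^esub> h) = \<psi> g \<otimes>\<^bsub>integer_group\<^esub> \<psi> h"
      using d by simp
  qed simp
  moreover have "bij_betw \<psi> (carrier G) UNIV"
  proof (rule bij_betw_imageI)
    show "inj_on \<psi> (carrier G)"
      using \<phi>(2) \<phi>\<psi> by (simp add: inj_on_def)
    have "k \<in> \<psi> ` carrier G" for k
    proof -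
      obtain g where "g \<in> carrier G" "\<phi> g = int d * k"
        using mult[OF d(2), of k] by (auto simp: I_def)
      then show ?thesis using d by (intro image_eqI[of _ _ g]) (simp_all add: \<psi>_def)
    qed
    then show "\<psi> ` carrier G = UNIV" by blast
  qed
  ultimately show ?thesis
    by (auto simp: is_iso_def iso_def)
qed

lemma product_group_reindex:
  assumes "bij_betw b J I"
  shows "product_group I (\<lambda>_. G) \<cong> product_group J (\<lambda>_. G)"
proof (rule is_isoI, rule isoI)
  let ?f = "\<lambda>f. \<lambda>j\<in>J. f (b j)" and ?g = "\<lambda>f. \<lambda>i\<in>I. f (inv_into J b i)"
  have bJ: "b j \<in> I" if "j \<in> J" for j
    using assms that by (rule bij_betw_apply)
  have bI: "inv_into J b i \<in> J" if "i \<in> I" for i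
    using bij_betw_inv_into[OF assms] that by (rule bij_betw_apply)
  show "?f \<in> hom (product_group I (\<lambda>_. G)) (product_group J (\<lambda>_. G))"
    by (rule homI) (simp_all add: bJ PiE_iff fun_eq_iff)
  show "bij_betw ?f (carrier (product_group I (\<lambda>_. G))) (carrier (product_group J (\<lambda>_. G)))"
  proof (rule bij_betw_byWitness[where f' = ?g])
    show "\<forall>f\<in>carrier (product_group I (\<lambda>_. G)). ?g (?f f) = f"
      by (simp add: bI bij_betw_inv_into_right[OF assms] PiE_iff extensional_def fun_eq_iff)
    show "\<forall>f\<in>carrier (product_group J (\<lambda>_. G)). ?f (?g f) = f"
      by (simp add: bJ bij_betw_inv_into_left[OF assms] PiE_iff extensional_def fun_eq_iff)
  qed (auto simp: bJ bI PiE_iff)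
qed

section \<open>Groups of permutations\<close>

text \<open>Houghton's group, the centraliser, the cyclic group and the subgroups in use all take
  this form, so that passing to a subgroup only changes the underlying set.\<close>

definition perm_group :: "('a \<Rightarrow> 'a) set \<Rightarrow> ('a \<Rightarrow> 'a) monoid" where
  "perm_group A = \<lparr> carrier = A, monoid.mult = (\<circ>), one = id \<rparr>"

lemma perm_group_simps [simp]:
  "carrier (perm_group A) = A"
  "monoid.mult (perm_group A) = (\<circ>)"
  "one (perm_group A) = id"
  by (simp_all add: perm_group_def)

lemma perm_group_carrier_update [simp]: "(perm_group A)\<lparr>carrier := B\<rparr> = perm_group B"
  by (simp add: perm_group_def)

locale perms =
  fixes C :: "('a \<Rightarrow> 'a) set"
  assumes id_mem: "id \<in> C"
    and comp_mem: "\<And>g h. g \<in> C \<Longrightarrow> h \<in> C \<Longrightarrow> g \<circ> h \<in> C"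
    and inv_mem: "\<And>g. g \<in> C \<Longrightarrow> inv' g \<in> C"
    and bij_mem: "\<And>g. g \<in> C \<Longrightarrow> bij g"
begin

lemma inv_apply [simp]: "g \<in> C \<Longrightarrow> inv' g (g s) = s" "g \<in> C \<Longrightarrow> g (inv' g s) = s"
  using bij_mem by (simp_all add: bij_is_inj bij_is_surj surj_f_inv_f)

lemma group_perm_group: "group (perm_group C)"
proof (rule groupI)
  fix g assume "g \<in> carrier (perm_group C)"
  then show "\<exists>h\<in>carrier (perm_group C). h \<otimes>\<^bsub>perm_group C\<^esub> g = \<one>\<^bsub>perm_group C\<^esub>"
    by (intro bexI[of _ "inv' g"]) (auto simp: inv_mem)
qed (auto simp: id_mem comp_mem comp_assoc)

lemma inv_perm_group: "g \<in> C \<Longrightarrow> inv\<^bsub>perm_group C\<^esub> g = inv' g"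
  by (rule group.inv_equality[OF group_perm_group]) (auto simp: inv_mem)

lemma subgroup_perm_group: "perms B \<Longrightarrow> B \<subseteq> C \<Longrightarrow> subgroup B (perm_group C)"
  by (auto intro!: group.subgroupI[OF group_perm_group] simp: inv_perm_group subset_iff
      perms.comp_mem perms.inv_mem dest: perms.id_mem)

end

section \<open>Invariant pieces and direct products\<close>

definition supported :: "('a \<Rightarrow> 'a) set \<Rightarrow> 'a set \<Rightarrow> ('a \<Rightarrow> 'a) set" where
  "supported C T = {g \<in> C. \<forall>s. s \<notin> T \<longrightarrow> g s = s}"

definition localize :: "'a set \<Rightarrow> ('a \<Rightarrow> 'a) \<Rightarrow> 'a \<Rightarrow> 'a" where
  "localize T g = (\<lambda>s. if s \<in> T then g s else s)"

text \<open>Invariance alone would not do: cutting an element down to T may lead out of C, as can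
  happen in Houghton's group when T meets a ray in an infinite set with infinite complement.\<close>

definition block :: "('a \<Rightarrow> 'a) set \<Rightarrow> 'a set \<Rightarrow> bool" where
  "block C T \<longleftrightarrow> (\<forall>g\<in>C. (\<forall>s\<in>T. g s \<in> T) \<and> localize T g \<in> C)"

context perms
begin

lemma perms_supported: "perms (supported C T)"
proof
  fix g assume g: "g \<in> supported C T"
  then have "inv' g s = s" if "s \<notin> T" for s
    using that by (metis (mono_tags, lifting) inv_apply(1) mem_Collect_eq supported_def)
  with g show "inv' g \<in> supported C T"
    by (auto simp: supported_def inv_mem)
qed (auto simp: supported_def id_mem comp_mem bij_mem)

text \<open>\<open>block\<close> only asks that images stay in T; applying it to the inverse of g
  gives the converse.\<close>

lemma block_apply_iff:
  assumes "block C T" "g \<in> C"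
  shows "g s \<in> T \<longleftrightarrow> s \<in> T"
  using assms inv_mem[OF assms(2)] unfolding block_def by (metis inv_apply(1))

lemma localize_comp:
  assumes "block C T" "g \<in> C" "h \<in> C"
  shows "localize T (g \<circ> h) = localize T g \<circ> localize T h"
  using block_apply_iff[OF assms(1)] assms by (auto simp: localize_def)

lemma localize_supported:
  assumes "block C T" "g \<in> C"
  shows "localize T g \<in> supported C T"
  using assms by (auto simp: supported_def block_def localize_def)

lemma localize_id: "g \<in> supported C T \<Longrightarrow> localize T g = g"
  by (auto simp: supported_def localize_def)

lemma localize_disjoint:
  assumes "g \<in> supported C T" "T \<inter> U = {}"
  shows "localize U g = id"
  using assms by (auto simp: supported_def localize_def fun_eq_iff)

lemma supported_comp_localize:
  assumes g: "g \<in> supported C T" and h: "h \<in> supported C U" and b: "block C T" "block C U"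
    and d: "T \<inter> U = {}"
  shows "localize T (g \<circ> h) = g" "localize U (g \<circ> h) = h"
proof -
  have C: "g \<in> C" "h \<in> C"
    using g h by (auto simp: supported_def)
  have d': "U \<inter> T = {}"
    using d by blast
  show "localize T (g \<circ> h) = g" "localize U (g \<circ> h) = h"
    by (simp_all add: localize_comp b C localize_id[OF g] localize_id[OF h] localize_disjoint[OF g d]
        localize_disjoint[OF h d'])
qed

text \<open>Restriction to T and to U in one direction, composition of elements with disjoint
  supports in the other.\<close>

lemma supported_Un_iso:
  assumes b: "block C T" "block C U" and d: "T \<inter> U = {}"
  shows "perm_group (supported C (T \<union> U)) \<cong>
    perm_group (supported C T) \<times>\<times> perm_group (supported C U)"
proof (rule is_isoI, rule isoI)
  let ?f = "\<lambda>g. (localize T g, localize U g)"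
  have C: "g \<in> C" if "g \<in> supported C V" for g V
    using that by (auto simp: supported_def)
  show "?f \<in> hom (perm_group (supported C (T \<union> U)))
      (perm_group (supported C T) \<times>\<times> perm_group (supported C U))"
    by (rule homI) (auto simp: DirProd_def localize_comp b C localize_supported)
  have inj: "inj_on ?f (supported C (T \<union> U))"
  proof (rule inj_onI)
    fix g h assume gh: "g \<in> supported C (T \<union> U)" "h \<in> supported C (T \<union> U)" "?f g = ?f h"
    show "g = h"
    proof
      fix s
      consider "s \<in> T" | "s \<in> U" | "s \<notin> T \<union> U" by blast
      then show "g s = h s"
      proof cases
        case 1 then show ?thesis using gh(3) by (auto simp: localize_def fun_eq_iff split: if_splits)
      next
        case 2 then show ?thesis using gh(3) by (auto simp: localize_def fun_eq_iff split: if_splits)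
      next
        case 3 then show ?thesis using gh(1,2) by (auto simp: supported_def)
      qed
    qed
  qed
  have "?f ` supported C (T \<union> U) = supported C T \<times> supported C U"
  proof (rule equalityI)
    show "?f ` supported C (T \<union> U) \<subseteq> supported C T \<times> supported C U"
      using localize_supported b C by auto
    show "supported C T \<times> supported C U \<subseteq> ?f ` supported C (T \<union> U)"
    proof
      fix x assume "x \<in> supported C T \<times> supported C U"
      then obtain g h where x: "x = (g, h)" "g \<in> supported C T" "h \<in> supported C U" by auto
      then have "g \<circ> h \<in> supported C (T \<union> U)" by (auto simp: supported_def comp_mem)
      moreover have "?f (g \<circ> h) = x"
        using supported_comp_localize[OF x(2,3) b d] x by simp
      ultimately show "x \<in> ?f ` supported C (T \<union> U)"
        by (intro image_eqI[of x ?f "g \<circ> h"]) simp_all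
    qed
  qed
  with inj show "bij_betw ?f (carrier (perm_group (supported C (T \<union> U))))
      (carrier (perm_group (supported C T) \<times>\<times> perm_group (supported C U)))"
    by (simp add: bij_betw_def)
qed

lemma supported_Union_iso:
  assumes fin: "finite \<P>" and b: "\<And>T. T \<in> \<P> \<Longrightarrow> block C T" and d: "pairwise disjnt \<P>"
  shows "perm_group (supported C (\<Union>\<P>)) \<cong> product_group \<P> (\<lambda>T. perm_group (supported C T))"
proof (rule is_isoI, rule isoI)
  let ?f = "\<lambda>g. \<lambda>T\<in>\<P>. localize T g"
  have C: "g \<in> C" if "g \<in> supported C V" for g V
    using that by (auto simp: supported_def)
  show "?f \<in> hom (perm_group (supported C (\<Union>\<P>)))
      (product_group \<P> (\<lambda>T. perm_group (supported C T)))"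
    by (rule homI) (auto simp: localize_comp b C localize_supported fun_eq_iff)
  have inj: "inj_on ?f (supported C (\<Union>\<P>))"
  proof (rule inj_onI)
    fix g h assume gh: "g \<in> supported C (\<Union>\<P>)" "h \<in> supported C (\<Union>\<P>)" "?f g = ?f h"
    have eq: "localize T g = localize T h" if "T \<in> \<P>" for T
      using fun_cong[OF gh(3), of T] that by simp
    show "g = h"
    proof
      fix s
      show "g s = h s"
      proof (cases "s \<in> \<Union>\<P>")
        case True
        then obtain T where "T \<in> \<P>" "s \<in> T" by blast
        then show ?thesis using fun_cong[OF eq, of T s] by (simp add: localize_def)
      next
        case False
        then show ?thesis using gh(1,2) unfolding supported_def by (metis (mono_tags, lifting) mem_Collect_eq)
      qed
    qed
  qed
  \<comment> \<open>The prescribed pieces are composed one after the other, by induction over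
    subfamilies; finiteness of the family enters here.\<close>
  have surj: "\<exists>g\<in>supported C (\<Union>\<Q>). \<forall>T\<in>\<Q>. localize T g = f T"
    if f: "\<And>T. T \<in> \<P> \<Longrightarrow> f T \<in> supported C T" and "\<Q> \<subseteq> \<P>" for f \<Q>
    using finite_subset[OF that(2) fin] that(2)
  proof (induction \<Q> rule: finite_induct)
    case empty
    show ?case by (intro bexI[of _ id]) (auto simp: supported_def id_mem)
  next
    case (insert U \<Q>)
    then obtain g where g: "g \<in> supported C (\<Union>\<Q>)" "\<forall>T\<in>\<Q>. localize T g = f T" by auto
    have U: "U \<in> \<P>" using insert by blast
    have dis: "U \<inter> T = {}" if "T \<in> \<Q>" for T
      using d insert that by (metis disjnt_def insert_subset pairwiseD subset_eq)
    have dis': "\<Union>\<Q> \<inter> U = {}"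
      using dis by blast
    have "f U \<circ> g \<in> supported C (\<Union>(insert U \<Q>))"
      using f[OF U] g by (auto simp: supported_def comp_mem)
    moreover have "localize U (f U \<circ> g) = f U"
      using C[OF f[OF U]] C[OF g(1)]
      by (simp add: localize_comp b U localize_id[OF f[OF U]] localize_disjoint[OF g(1) dis'])
    moreover have "localize T (f U \<circ> g) = f T" if "T \<in> \<Q>" for T
      using g f[OF U] C dis[OF that] that insert.prems
      by (subst localize_comp) (auto simp: b localize_disjoint[OF f[OF U]])
    ultimately show ?case by (intro bexI[of _ "f U \<circ> g"]) blast+
  qed
  have "?f ` supported C (\<Union>\<P>) = (\<Pi>\<^sub>E T\<in>\<P>. supported C T)"
  proof (rule equalityI)
    show "?f ` supported C (\<Union>\<P>) \<subseteq> (\<Pi>\<^sub>E T\<in>\<P>. supported C T)"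
      using localize_supported b C by auto
    show "(\<Pi>\<^sub>E T\<in>\<P>. supported C T) \<subseteq> ?f ` supported C (\<Union>\<P>)"
    proof
      fix f assume f: "f \<in> (\<Pi>\<^sub>E T\<in>\<P>. supported C T)"
      then obtain g where "g \<in> supported C (\<Union>\<P>)" "\<forall>T\<in>\<P>. localize T g = f T"
        using surj[of f \<P>] by (auto dest: PiE_mem)
      moreover from this have "?f g = f"
        using f by (auto simp: PiE_iff extensional_def)
      ultimately show "f \<in> ?f ` supported C (\<Union>\<P>)"
        by (intro image_eqI[of f ?f g]) simp_all
    qed
  qed
  with inj show "bij_betw ?f (carrier (perm_group (supported C (\<Union>\<P>))))
      (carrier (product_group \<P> (\<lambda>T. perm_group (supported C T))))"
    by (simp add: bij_betw_def)
qed

end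

section \<open>Transport along a bijection\<close>

definition conjugate :: "('a \<Rightarrow> 'b) \<Rightarrow> 'a set \<Rightarrow> 'b set \<Rightarrow> ('a \<Rightarrow> 'a) \<Rightarrow> 'b \<Rightarrow> 'b" where
  "conjugate \<beta> U Y h = (\<lambda>y. if y \<in> Y then \<beta> (h (inv_into U \<beta> y)) else y)"

lemma conjugate_conjugate:
  assumes "bij_betw \<beta> U Y" "h permutes U"
  shows "conjugate (inv_into U \<beta>) Y U (conjugate \<beta> U Y h) = h"
proof
  fix x
  have i: "inv_into Y (inv_into U \<beta>) x = \<beta> x" if "x \<in> U"
    using assms(1) that by (rule inv_into_inv_into_eq)
  show "conjugate (inv_into U \<beta>) Y U (conjugate \<beta> U Y h) x = h x"
    using assms i permutes_in_image[OF assms(2), of x] permutes_not_in[OF assms(2), of x]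
    by (auto simp: conjugate_def bij_betw_inv_into_left bij_betw_apply)
qed

text \<open>The assumptions \<open>AB\<close> and \<open>BA\<close> isolate what depends on the
  groups: for symmetric groups just being a permutation, for Houghton's groups also the preservation
  of eventual translations.\<close>

lemma conjugate_iso:
  assumes \<beta>: "bij_betw \<beta> U Y" and A: "\<And>h. h \<in> A \<Longrightarrow> h permutes U"
    and B: "\<And>h. h \<in> B \<Longrightarrow> h permutes Y"
    and AB: "\<And>h. h \<in> A \<Longrightarrow> conjugate \<beta> U Y h \<in> B"
    and BA: "\<And>h. h \<in> B \<Longrightarrow> conjugate (inv_into U \<beta>) Y U h \<in> A"
  shows "perm_group A \<cong> perm_group B"
proof (rule is_isoI, rule isoI)
  have \<beta>': "bij_betw (inv_into U \<beta>) Y U"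
    using \<beta> by (rule bij_betw_inv_into)
  show "conjugate \<beta> U Y \<in> hom (perm_group A) (perm_group B)"
  proof (rule homI)
    fix g h assume "g \<in> carrier (perm_group A)" "h \<in> carrier (perm_group A)"
    then have "g permutes U" "h permutes U" using A by auto
    then show "conjugate \<beta> U Y (g \<otimes>\<^bsub>perm_group A\<^esub> h) =
      conjugate \<beta> U Y g \<otimes>\<^bsub>perm_group B\<^esub> conjugate \<beta> U Y h"
      using bij_betw_apply[OF \<beta>] bij_betw_apply[OF \<beta>'] bij_betw_inv_into_left[OF \<beta>]
      by (auto simp: conjugate_def fun_eq_iff permutes_in_image)
  qed (use AB in auto)
  have "conjugate \<beta> U Y (conjugate (inv_into U \<beta>) Y U h) = h" if "h \<in> B" for h
  proof -
    have "conjugate (inv_into Y (inv_into U \<beta>)) U Y (conjugate (inv_into U \<beta>) Y U h) = h"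
      using conjugate_conjugate[OF \<beta>' B[OF that]] .
    moreover have "conjugate (inv_into Y (inv_into U \<beta>)) U Y k = conjugate \<beta> U Y k"
      if "k permutes U" for k
      using inv_into_inv_into_eq[OF \<beta>] inv_into_inv_into_eq[OF \<beta>'] bij_betw_apply[OF \<beta>']
      by (simp add: conjugate_def fun_eq_iff permutes_in_image[OF that])
    ultimately show ?thesis using A[OF BA[OF that]] by simp
  qed
  then show "bij_betw (conjugate \<beta> U Y) (carrier (perm_group A)) (carrier (perm_group B))"
    by (intro bij_betw_byWitness[where f' = "conjugate (inv_into U \<beta>) Y U"])
      (auto simp: AB BA conjugate_conjugate[OF \<beta> A])
qed

lemma conjugate_permutes:
  assumes "bij_betw \<beta> U Y" "h permutes U"
  shows "conjugate \<beta> U Y h permutes Y"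
proof (rule bij_imp_permutes)
  have "bij_betw (\<beta> \<circ> h \<circ> inv_into U \<beta>) Y Y"
    using bij_betw_trans[OF bij_betw_inv_into[OF assms(1)]
        bij_betw_trans[OF permutes_imp_bij[OF assms(2)] assms(1)]] .
  then show "bij_betw (conjugate \<beta> U Y h) Y Y"
    by (subst bij_betw_cong[of _ _ "\<beta> \<circ> h \<circ> inv_into U \<beta>"]) (auto simp: conjugate_def)
qed (simp add: conjugate_def)

lemma permutes_iso_sym_group:
  assumes "finite U"
  shows "perm_group {h. h permutes U} \<cong> sym_group (card U)"
proof -
  obtain \<beta> where \<beta>: "bij_betw \<beta> U {1..card U}"
    using ex_bij_betw_nat_finite_1[OF assms] bij_betw_inv by blast
  have "perm_group {h. h permutes U} \<cong> perm_group {h. h permutes {1..card U}}"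
    by (rule conjugate_iso[OF \<beta>], unfold mem_Collect_eq)
      (fact conjugate_permutes[OF \<beta>] conjugate_permutes[OF bij_betw_inv_into[OF \<beta>]] | assumption)+
  then show ?thesis
    by (simp add: perm_group_def sym_group_def)
qed

section \<open>Wreath products\<close>

text \<open>The situation on one part: an abelian Q acts on a finite set with the same stabiliser K
  at every point, so Q/K acts freely. Q itself may be infinite.\<close>

locale uniform_action = perms Q for Q :: "('a \<Rightarrow> 'a) set" +
  fixes P :: "'a set" and K :: "('a \<Rightarrow> 'a) set"
  assumes comm: "\<And>u v. u \<in> Q \<Longrightarrow> v \<in> Q \<Longrightarrow> u \<circ> v = v \<circ> u"
    and finite_P: "finite P"
    and nonempty_P: "P \<noteq> {}"
    and maps_to: "\<And>u p. u \<in> Q \<Longrightarrow> p \<in> P \<Longrightarrow> u p \<in> P"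
    and stab_eq: "\<And>p. p \<in> P \<Longrightarrow> K = {u \<in> Q. u p = p}"
begin

abbreviation (input) "G \<equiv> perm_group Q"

lemma comm_group_Q: "comm_group G"
  by (rule group.group_comm_groupI[OF group_perm_group]) (auto simp: comm)

text \<open>The inverse of v composed with u fixes one point of P, hence lies in the common
  stabiliser K and fixes all of P.\<close>

lemma agree:
  assumes "u \<in> Q" "v \<in> Q" "p \<in> P" "p' \<in> P" "u p = v p"
  shows "u p' = v p'"
proof -
  have "inv' v \<circ> u \<in> K"
    using assms stab_eq[of p] by (auto simp: comp_mem inv_mem)
  then have "inv' v (u p') = p'"
    using assms stab_eq[of p'] by auto
  then show ?thesis
    using assms(2) by (metis inv_apply(2))
qed

lemma comm_apply: "u \<in> Q \<Longrightarrow> v \<in> Q \<Longrightarrow> u (v p) = v (u p)"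
  using comm by (metis comp_apply)

text \<open>A coset of K is recognised by the image of a single point, and any point of P serves for
  this.\<close>

lemma r_coset_eq:
  assumes "u \<in> Q" "p \<in> P"
  shows "K #>\<^bsub>G\<^esub> u = {v \<in> Q. v p = u p}"
proof (rule equalityI)
  show "K #>\<^bsub>G\<^esub> u \<subseteq> {v \<in> Q. v p = u p}"
    using assms stab_eq[OF maps_to[OF assms]] by (auto simp: r_coset_def comp_mem)
  show "{v \<in> Q. v p = u p} \<subseteq> K #>\<^bsub>G\<^esub> u"
  proof
    fix v assume v: "v \<in> {v \<in> Q. v p = u p}"
    have "v \<circ> inv' u \<in> K"
      using stab_eq[OF maps_to[OF assms]] v assms by (auto simp: comp_mem inv_mem)
    moreover have "v = (v \<circ> inv' u) \<circ> u"
      using assms by (auto simp: fun_eq_iff)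
    ultimately show "v \<in> K #>\<^bsub>G\<^esub> u"
      by (auto simp: r_coset_def)
  qed
qed

lemma subgroup_K: "subgroup K G"
proof -
  obtain p where p: "p \<in> P" using nonempty_P by blast
  have "inv' u p = p" if "u \<in> Q" "u p = p" for u
    using that by (metis inv_apply(1))
  then have "perms K"
    unfolding stab_eq[OF p] by unfold_locales (auto simp: id_mem comp_mem inv_mem bij_mem)
  then show ?thesis
    by (rule subgroup_perm_group) (auto simp: stab_eq[OF p])
qed

lemma rcosetsE:
  assumes "c \<in> rcosets\<^bsub>G\<^esub> K"
  obtains u where "u \<in> Q" "u \<in> c" "\<And>p. p \<in> P \<Longrightarrow> c = {v \<in> Q. v p = u p}"
proof -
  obtain u where u: "u \<in> Q" "c = K #>\<^bsub>G\<^esub> u"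
    using assms by (auto simp: RCOSETS_def)
  show thesis
    using that[of u] u r_coset_eq nonempty_P by auto
qed

lemma rcosets_mem: "u \<in> Q \<Longrightarrow> p \<in> P \<Longrightarrow> {v \<in> Q. v p = u p} \<in> rcosets\<^bsub>G\<^esub> K"
  using r_coset_eq by (force simp: RCOSETS_def)

text \<open>Orbit-stabiliser: a point of the orbit corresponds to the coset of the elements sending
  p to it.\<close>

lemma card_orbit:
  assumes "p \<in> P"
  shows "card ((\<lambda>u. u p) ` Q) = subgroup_index G K"
proof -
  let ?f = "\<lambda>p'. {v \<in> Q. v p = p'}"
  have "rcosets\<^bsub>G\<^esub> K = ?f ` (\<lambda>u. u p) ` Q"
    using rcosets_mem[OF _ assms] assms by (auto elim!: rcosetsE)
  moreover have "inj_on ?f ((\<lambda>u. u p) ` Q)"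
    by (rule inj_onI) blast
  ultimately show ?thesis
    by (simp add: subgroup_index_def card_image)
qed

section \<open>Orbits and their representatives\<close>

definition orbs :: "'a set set" where
  "orbs = (\<lambda>p. (\<lambda>u. u p) ` Q) ` P"

lemma orbit_eq:
  assumes "u \<in> Q"
  shows "(\<lambda>v. v (u p)) ` Q = (\<lambda>v. v p) ` Q"
proof -
  have "v (u p) \<in> (\<lambda>v. v p) ` Q" if "v \<in> Q" for v
    using comp_mem[OF that assms] by (force intro: image_eqI[of _ _ "v \<circ> u"])
  moreover have "v p \<in> (\<lambda>v. v (u p)) ` Q" if "v \<in> Q" for v
    using comp_mem[OF that inv_mem[OF assms]] assms by (force intro: image_eqI[of _ _ "v \<circ> inv' u"])
  ultimately show ?thesis by blast
qed

text \<open>The orbits partition P into sets of size |Q : K|. Hence the division that yields the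
  degree of the symmetric group is exact.\<close>

lemma card_P: "card P = subgroup_index G K * card orbs"
proof -
  have U: "\<Union>orbs = P"
  proof (rule equalityI)
    show "\<Union>orbs \<subseteq> P" using maps_to by (auto simp: orbs_def)
    show "P \<subseteq> \<Union>orbs"
    proof
      fix p assume "p \<in> P"
      moreover have "p \<in> (\<lambda>u. u p) ` Q"
        using id_mem by (intro image_eqI[of _ _ id]) simp_all
      ultimately show "p \<in> \<Union>orbs" by (auto simp: orbs_def)
    qed
  qed
  have "subgroup_index G K * card orbs = card (\<Union>orbs)"
  proof (rule card_partition)
    show "finite orbs" by (simp add: orbs_def finite_P)
    show "finite (\<Union>orbs)" using U finite_P by simp
    show "card c = subgroup_index G K" if "c \<in> orbs" for c
      using that card_orbit by (auto simp: orbs_def)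
    show "c1 \<inter> c2 = {}" if c: "c1 \<in> orbs" "c2 \<in> orbs" "c1 \<noteq> c2" for c1 c2
    proof (rule ccontr)
      assume "c1 \<inter> c2 \<noteq> {}"
      moreover obtain p1 p2 where p: "c1 = (\<lambda>u. u p1) ` Q" "c2 = (\<lambda>u. u p2) ` Q"
        using c by (auto simp: orbs_def)
      ultimately obtain u1 u2 where "u1 \<in> Q" "u2 \<in> Q" "u1 p1 = u2 p2"
        by auto
      then show False
        using p c(3) orbit_eq by metis
    qed
  qed
  with U show ?thesis by simp
qed

lemma subgroup_index_dvd: "subgroup_index G K dvd card P"
  by (simp add: card_P)

lemma card_orbs: "card orbs = card P div subgroup_index G K"
proof -
  have "card P > 0"
    using finite_P nonempty_P by (simp add: card_gt_0_iff)
  then have "subgroup_index G K > 0"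
    using card_P by simp
  then show ?thesis
    using card_P by simp
qed

lemma transversal:
  obtains e where "\<And>i. i \<in> {1..card orbs} \<Longrightarrow> e i \<in> P"
    "\<And>p. p \<in> P \<Longrightarrow> \<exists>i\<in>{1..card orbs}. \<exists>u\<in>Q. p = u (e i)"
    "\<And>i j u v. i \<in> {1..card orbs} \<Longrightarrow> j \<in> {1..card orbs} \<Longrightarrow> u \<in> Q \<Longrightarrow> v \<in> Q \<Longrightarrow>
      u (e i) = v (e j) \<Longrightarrow> i = j"
proof -
  have "finite orbs" by (simp add: orbs_def finite_P)
  then obtain b where b: "bij_betw b {1..card orbs} orbs"
    using ex_bij_betw_nat_finite_1 by blast
  have "\<exists>p\<in>P. b i = (\<lambda>u. u p) ` Q" if "i \<in> {1..card orbs}" for i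
    using bij_betw_apply[OF b that] by (auto simp: orbs_def)
  then obtain e where e: "\<And>i. i \<in> {1..card orbs} \<Longrightarrow> e i \<in> P \<and> b i = (\<lambda>u. u (e i)) ` Q"
    by metis
  show thesis
  proof (rule that)
    fix p assume "p \<in> P"
    then have "(\<lambda>u. u p) ` Q \<in> orbs" by (simp add: orbs_def)
    then obtain i where i: "i \<in> {1..card orbs}" "b i = (\<lambda>u. u p) ` Q"
      using b by (metis bij_betw_def imageE)
    have "p \<in> (\<lambda>u. u p) ` Q" using id_mem by (intro image_eqI[of _ _ id]) simp_all
    then show "\<exists>i\<in>{1..card orbs}. \<exists>u\<in>Q. p = u (e i)"
      using e[OF i(1)] i by auto
  next
    fix i j u v assume ij: "i \<in> {1..card orbs}" "j \<in> {1..card orbs}" "u \<in> Q" "v \<in> Q"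
      "u (e i) = v (e j)"
    then have "b i = b j" using e orbit_eq by metis
    then show "i = j" using inj_onD[OF bij_betw_imp_inj_on[OF b] _ ij(1,2)] by blast
  qed (use e in blast)
qed

text \<open>In an abelian group every element normalises K.\<close>

lemma Weyl_group_eq: "Weyl_group G K = G Mod K"
proof -
  have "u <#\<^bsub>G\<^esub> K #>\<^bsub>G\<^esub> inv\<^bsub>G\<^esub> u = K" if "u \<in> Q" for u
    using comm_group.conjugate_coset_eq[OF comm_group_Q subgroup.subset[OF subgroup_K]] that by simp
  then have "normalizer G K = Q"
    using subgroup.subset[OF subgroup_K] by (auto simp: normalizer_def stabilizer_def)
  then show ?thesis by (simp add: Weyl_group_def)
qed

text \<open>This is the action of Q/K through an arbitrary representative; by \<open>act_eq\<close>
  the choice does not matter on points of P.\<close>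

definition act :: "('a \<Rightarrow> 'a) set \<Rightarrow> 'a \<Rightarrow> 'a" where
  "act c p = (SOME u. u \<in> c) p"

lemma act_eq:
  assumes "c \<in> rcosets\<^bsub>G\<^esub> K" "u \<in> c" "p \<in> P"
  shows "act c p = u p"
proof -
  have "(SOME u. u \<in> c) \<in> c" using assms(2) by (rule someI[of "\<lambda>u. u \<in> c"])
  with assms show ?thesis unfolding act_def
    by (elim rcosetsE) (auto simp: act_def)
qed

lemma act_in:
  assumes "c \<in> rcosets\<^bsub>G\<^esub> K" "p \<in> P"
  shows "\<exists>u\<in>Q. u \<in> c \<and> act c p = u p"
proof -
  obtain u where "u \<in> Q" "u \<in> c"
    using assms(1) by (rule rcosetsE)
  then show ?thesis
    using act_eq[OF assms(1) _ assms(2)] by blast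
qed

text \<open>Freeness of the action of Q/K: a coset can be recovered from its effect on one
  point.\<close>

lemma act_eqD:
  assumes "c \<in> rcosets\<^bsub>G\<^esub> K" "d \<in> rcosets\<^bsub>G\<^esub> K" "p \<in> P" "act c p = act d p"
  shows "c = d"
proof -
  obtain u where "u \<in> c" "c = {w \<in> Q. w p = u p}"
    using assms(1,3) by (elim rcosetsE) blast
  moreover obtain v where "v \<in> d" "d = {w \<in> Q. w p = v p}"
    using assms(2,3) by (elim rcosetsE) blast
  ultimately show ?thesis
    using act_eq[OF assms(1) _ assms(3)] act_eq[OF assms(2) _ assms(3)] assms(4) by metis
qed

lemma act_set_mult:
  assumes "c \<in> rcosets\<^bsub>G\<^esub> K" "d \<in> rcosets\<^bsub>G\<^esub> K" "p \<in> P"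
  shows "c <#>\<^bsub>G\<^esub> d \<in> rcosets\<^bsub>G\<^esub> K" "act (c <#>\<^bsub>G\<^esub> d) p = act c (act d p)"
proof -
  interpret normal K G
    using comm_group.subgroup_imp_normal[OF comm_group_Q subgroup_K] .
  show c: "c <#>\<^bsub>G\<^esub> d \<in> rcosets\<^bsub>G\<^esub> K"
    using setmult_closed[OF assms(1,2)] .
  obtain u v where uv: "u \<in> c" "v \<in> d" "u \<in> Q" "v \<in> Q"
    using act_in[OF assms(1,3)] act_in[OF assms(2,3)] by blast
  then have "u \<circ> v \<in> c <#>\<^bsub>G\<^esub> d"
    by (auto simp: set_mult_def)
  then show "act (c <#>\<^bsub>G\<^esub> d) p = act c (act d p)"
    using act_eq[OF c] act_eq[OF assms(1) uv(1)] act_eq[OF assms(2) uv(2)] uv assms(3) maps_to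
    by auto
qed

text \<open>With \<open>e 1, \<dots>, e r\<close> representing the orbits, \<open>(f, \<sigma>)\<close> sends \<open>u (e i)\<close> to
  \<open>u (w (e (\<sigma> i)))\<close> for any \<open>w \<in> f (\<sigma> i)\<close>; neither the choice of \<open>u\<close> nor that of \<open>w\<close> matters.\<close>

definition induced :: "nat \<Rightarrow> (nat \<Rightarrow> 'a) \<Rightarrow> (nat \<Rightarrow> ('a \<Rightarrow> 'a) set) \<times> (nat \<Rightarrow> nat) \<Rightarrow> 'a \<Rightarrow> 'a" where
  "induced r e = (\<lambda>(f, \<sigma>) p. if p \<in> P
     then case SOME (i, u). i \<in> {1..r} \<and> u \<in> Q \<and> p = u (e i) of (i, u) \<Rightarrow> u (act (f (\<sigma> i)) (e (\<sigma> i)))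
     else p)"

text \<open>An equivariant permutation is determined by the images of the orbit representatives: it
  permutes the orbits and, in each target orbit, singles out a coset of K. The isomorphism is built
  starting from the wreath product and inverted at the end.\<close>

lemma commutant_iso_wreath:
  "perm_group {g. g permutes P \<and> (\<forall>u\<in>Q. \<forall>p\<in>P. g (u p) = u (g p))} \<cong>
     wreath_sym (Weyl_group G K) (card P div subgroup_index G K)"
proof -
  define r where "r = card orbs"
  define W where "W = wreath_sym (G Mod K) r"
  define A where "A = {g. g permutes P \<and> (\<forall>u\<in>Q. \<forall>p\<in>P. g (u p) = u (g p))}"
  obtain e where e: "\<And>i. i \<in> {1..r} \<Longrightarrow> e i \<in> P"
    and e_ex: "\<And>p. p \<in> P \<Longrightarrow> \<exists>i\<in>{1..r}. \<exists>u\<in>Q. p = u (e i)"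
    and e_unique: "\<And>i j u v. i \<in> {1..r} \<Longrightarrow> j \<in> {1..r} \<Longrightarrow> u \<in> Q \<Longrightarrow> v \<in> Q \<Longrightarrow>
      u (e i) = v (e j) \<Longrightarrow> i = j"
    unfolding r_def using transversal by blast
  define \<Phi> where "\<Phi> = induced r e"
  have carrier_W: "carrier W = ({1..r} \<rightarrow>\<^sub>E rcosets\<^bsub>G\<^esub> K) \<times> {\<sigma>. \<sigma> permutes {1..r}}"
    by (simp add: W_def wreath_sym_def semidirect_product_def FactGroup_def sym_group_def)
  have mult_W: "(f, \<sigma>) \<otimes>\<^bsub>W\<^esub> (g, \<tau>) =
      ((\<lambda>i\<in>{1..r}. f i <#>\<^bsub>G\<^esub> (\<lambda>i\<in>{1..r}. g (inv' \<sigma> i)) i), \<sigma> \<circ> \<tau>)" for f g \<sigma> \<tau>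
    by (simp add: W_def wreath_sym_def semidirect_product_def FactGroup_def sym_group_def)
  have \<Phi>: "\<Phi> (f, \<sigma>) (u (e i)) = u (act (f (\<sigma> i)) (e (\<sigma> i)))"
    if f: "f \<in> {1..r} \<rightarrow>\<^sub>E rcosets\<^bsub>G\<^esub> K" and \<sigma>: "\<sigma> permutes {1..r}" and i: "i \<in> {1..r}" and u: "u \<in> Q"
    for f \<sigma> u i
  proof -
    obtain j v where jv: "(SOME (j, v). j \<in> {1..r} \<and> v \<in> Q \<and> u (e i) = v (e j)) = (j, v)"
      by fastforce
    have "case (SOME (j, v). j \<in> {1..r} \<and> v \<in> Q \<and> u (e i) = v (e j)) of (j, v) \<Rightarrow>
        j \<in> {1..r} \<and> v \<in> Q \<and> u (e i) = v (e j)"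
      by (rule someI[of _ "(i, u)"]) (use i u in auto)
    then have j: "j \<in> {1..r}" "v \<in> Q" "u (e i) = v (e j)"
      using jv by auto
    \<comment> \<open>The choice operator may return another v than u, but the orbit index is
      forced, and \<open>agree\<close> then identifies the values.\<close>
    then have [simp]: "j = i"
      using e_unique i u by metis
    have \<sigma>i: "\<sigma> i \<in> {1..r}"
      using \<sigma> i by (simp add: permutes_in_image del: atLeastAtMost_iff)
    then have "act (f (\<sigma> i)) (e (\<sigma> i)) \<in> P"
      using act_in[OF PiE_mem[OF f \<sigma>i] e[OF \<sigma>i]] e[OF \<sigma>i] maps_to by auto
    then have "v (act (f (\<sigma> i)) (e (\<sigma> i))) = u (act (f (\<sigma> i)) (e (\<sigma> i)))"
      using agree[of v u "e i"] j u e[OF i] by auto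
    then show ?thesis
      using jv maps_to[OF u e[OF i]] by (simp add: \<Phi>_def induced_def)
  qed
  have \<Phi>_out: "\<Phi> w p = p" if "p \<notin> P" for w p
    using that by (auto simp: \<Phi>_def induced_def split: prod.splits)
  have target: "act (f (\<sigma> i)) (e (\<sigma> i)) \<in> P" "\<sigma> i \<in> {1..r}"
     "\<exists>w\<in>Q. w \<in> f (\<sigma> i) \<and> act (f (\<sigma> i)) (e (\<sigma> i)) = w (e (\<sigma> i))"
    if f: "f \<in> {1..r} \<rightarrow>\<^sub>E rcosets\<^bsub>G\<^esub> K" and \<sigma>: "\<sigma> permutes {1..r}" and i: "i \<in> {1..r}"
    for f \<sigma> i
  proof -
    show \<sigma>i: "\<sigma> i \<in> {1..r}"
      using \<sigma> i by (simp add: permutes_in_image del: atLeastAtMost_iff)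
    show *: "\<exists>w\<in>Q. w \<in> f (\<sigma> i) \<and> act (f (\<sigma> i)) (e (\<sigma> i)) = w (e (\<sigma> i))"
      using act_in[OF PiE_mem[OF f \<sigma>i] e[OF \<sigma>i]] .
    then show "act (f (\<sigma> i)) (e (\<sigma> i)) \<in> P"
      using e[OF \<sigma>i] maps_to by auto
  qed
  have \<Phi>_mem: "\<Phi> (f, \<sigma>) \<in> A"
    if f: "f \<in> {1..r} \<rightarrow>\<^sub>E rcosets\<^bsub>G\<^esub> K" and \<sigma>: "\<sigma> permutes {1..r}" for f \<sigma>
  proof -
    have into: "\<Phi> (f, \<sigma>) p \<in> P" if "p \<in> P" for p
      using e_ex[OF that] \<Phi>[OF f \<sigma>] target(1)[OF f \<sigma>] maps_to by auto
    have "inj_on (\<Phi> (f, \<sigma>)) P"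
    proof (rule inj_onI)
      fix p p' assume p: "p \<in> P" "p' \<in> P" "\<Phi> (f, \<sigma>) p = \<Phi> (f, \<sigma>) p'"
      obtain i u j v where iu: "i \<in> {1..r}" "u \<in> Q" "p = u (e i)" "j \<in> {1..r}" "v \<in> Q" "p' = v (e j)"
        using e_ex p by metis
      obtain w x where wx: "w \<in> Q" "act (f (\<sigma> i)) (e (\<sigma> i)) = w (e (\<sigma> i))"
         "x \<in> Q" "act (f (\<sigma> j)) (e (\<sigma> j)) = x (e (\<sigma> j))"
        using target(3)[OF f \<sigma>] iu by metis
      have eq: "u (act (f (\<sigma> i)) (e (\<sigma> i))) = v (act (f (\<sigma> j)) (e (\<sigma> j)))"
        using p(3) iu \<Phi>[OF f \<sigma>] by auto
      then have "(u \<circ> w) (e (\<sigma> i)) = (v \<circ> x) (e (\<sigma> j))"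
        using wx by simp
      then have "\<sigma> i = \<sigma> j"
        using e_unique[OF target(2)[OF f \<sigma> iu(1)] target(2)[OF f \<sigma> iu(4)]]
          comp_mem[OF iu(2) wx(1)] comp_mem[OF iu(5) wx(3)] by blast
      then have ij: "i = j"
        using permutes_inj[OF \<sigma>] by (simp add: inj_eq)
      then show "p = p'"
        using agree[OF iu(2,5) target(1)[OF f \<sigma> iu(1)] e[OF iu(1)]] eq iu by simp
    qed
    then have "\<Phi> (f, \<sigma>) permutes P"
      using into \<Phi>_out finite_P
      by (intro bij_imp_permutes bij_betw_imageI endo_inj_surj) auto
    moreover have "\<Phi> (f, \<sigma>) (u p) = u (\<Phi> (f, \<sigma>) p)" if "u \<in> Q" "p \<in> P" for u p
    proof -
      obtain i v where iv: "i \<in> {1..r}" "v \<in> Q" "p = v (e i)"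
        using e_ex \<open>p \<in> P\<close> by metis
      then show ?thesis
        using \<Phi>[OF f \<sigma> iv(1), of "u \<circ> v"] \<Phi>[OF f \<sigma> iv(1,2)] comp_mem[OF \<open>u \<in> Q\<close> iv(2)] by simp
    qed
    ultimately show ?thesis by (simp add: A_def)
  qed
  have closed: "x \<otimes>\<^bsub>W\<^esub> y \<in> carrier W" if "x \<in> carrier W" "y \<in> carrier W" for x y
  proof -
    obtain f \<sigma> g \<tau> where xy: "x = (f, \<sigma>)" "y = (g, \<tau>)" by (meson surj_pair)
    then have fg: "f \<in> {1..r} \<rightarrow>\<^sub>E rcosets\<^bsub>G\<^esub> K" "g \<in> {1..r} \<rightarrow>\<^sub>E rcosets\<^bsub>G\<^esub> K"
        "\<sigma> permutes {1..r}" "\<tau> permutes {1..r}"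
      using that by (auto simp: carrier_W)
    have "inv' \<sigma> i \<in> {1..r}" if "i \<in> {1..r}" for i
      using permutes_in_image[OF permutes_inv[OF fg(3)]] that by blast
    then have "f i <#>\<^bsub>G\<^esub> g (inv' \<sigma> i) \<in> rcosets\<^bsub>G\<^esub> K" if "i \<in> {1..r}" for i
      using act_set_mult(1)[OF PiE_mem[OF fg(1)] PiE_mem[OF fg(2)]] that nonempty_P by blast
    then show ?thesis
      using fg(3,4) by (auto simp: xy mult_W carrier_W intro: permutes_compose)
  qed
  have hom: "\<Phi> \<in> hom W (perm_group A)"
  proof (rule homI)
    fix x assume "x \<in> carrier W"
    then show "\<Phi> x \<in> carrier (perm_group A)"
      using \<Phi>_mem by (auto simp: carrier_W)
  next
    fix x y assume xyW: "x \<in> carrier W" "y \<in> carrier W"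
    obtain f \<sigma> g \<tau> where xy: "x = (f, \<sigma>)" "y = (g, \<tau>)" by (meson surj_pair)
    then have fg: "f \<in> {1..r} \<rightarrow>\<^sub>E rcosets\<^bsub>G\<^esub> K" "g \<in> {1..r} \<rightarrow>\<^sub>E rcosets\<^bsub>G\<^esub> K"
        "\<sigma> permutes {1..r}" "\<tau> permutes {1..r}"
      using xyW by (auto simp: carrier_W)
    define h where "h = (\<lambda>i\<in>{1..r}. f i <#>\<^bsub>G\<^esub> (\<lambda>i\<in>{1..r}. g (inv' \<sigma> i)) i)"
    have h: "x \<otimes>\<^bsub>W\<^esub> y = (h, \<sigma> \<circ> \<tau>)"
      by (simp add: xy mult_W h_def)
    then have hc: "h \<in> {1..r} \<rightarrow>\<^sub>E rcosets\<^bsub>G\<^esub> K" "\<sigma> \<circ> \<tau> permutes {1..r}"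
      using closed[OF xyW] by (auto simp: carrier_W)
    have "\<Phi> (h, \<sigma> \<circ> \<tau>) p = (\<Phi> (f, \<sigma>) \<circ> \<Phi> (g, \<tau>)) p" for p
    proof (cases "p \<in> P")
      case True
      then obtain i u where iu: "i \<in> {1..r}" "u \<in> Q" "p = u (e i)"
        using e_ex by metis
      note \<tau>i = target(2)[OF fg(2,4) iu(1)]
      note \<sigma>\<tau>i = target(2)[OF fg(1,3) \<tau>i]
      obtain w where w: "w \<in> Q" "w \<in> g (\<tau> i)" "act (g (\<tau> i)) (e (\<tau> i)) = w (e (\<tau> i))"
        using target(3)[OF fg(2,4) iu(1)] by blast
      \<comment> \<open>The twist by the inverse of \<sigma> in the wreath multiplication cancels
        \<sigma>, so the coordinate at \<sigma> (\<tau> i) involves g at \<tau> i.\<close>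
      have "h ((\<sigma> \<circ> \<tau>) i) = f (\<sigma> (\<tau> i)) <#>\<^bsub>G\<^esub> g (\<tau> i)"
        using \<sigma>\<tau>i permutes_inverses(2)[OF fg(3)] by (simp add: h_def)
      then have "\<Phi> (h, \<sigma> \<circ> \<tau>) p = u (act (f (\<sigma> (\<tau> i))) (act (g (\<tau> i)) (e (\<sigma> (\<tau> i)))))"
        using \<Phi>[OF hc iu(1,2)] iu(3)
          act_set_mult(2)[OF PiE_mem[OF fg(1) \<sigma>\<tau>i] PiE_mem[OF fg(2) \<tau>i] e[OF \<sigma>\<tau>i]] by simp
      \<comment> \<open>The representative w was found at the point e (\<tau> i), but it computes
        the action of its coset at every point of P.\<close>
      also have "act (g (\<tau> i)) (e (\<sigma> (\<tau> i))) = w (e (\<sigma> (\<tau> i)))"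
        using act_eq[OF PiE_mem[OF fg(2) \<tau>i] w(2) e[OF \<sigma>\<tau>i]] .
      finally have 1: "\<Phi> (h, \<sigma> \<circ> \<tau>) p = u (act (f (\<sigma> (\<tau> i))) (w (e (\<sigma> (\<tau> i)))))" .
      obtain x where x: "x \<in> Q" "x \<in> f (\<sigma> (\<tau> i))" "\<And>p. p \<in> P \<Longrightarrow> act (f (\<sigma> (\<tau> i))) p = x p"
        using act_in[OF PiE_mem[OF fg(1) \<sigma>\<tau>i] e[OF \<sigma>\<tau>i]] act_eq[OF PiE_mem[OF fg(1) \<sigma>\<tau>i]] by blast
      have "\<Phi> (f, \<sigma>) (\<Phi> (g, \<tau>) p) = \<Phi> (f, \<sigma>) ((u \<circ> w) (e (\<tau> i)))"
        using \<Phi>[OF fg(2,4) iu(1,2)] iu w by simp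
      also have "\<dots> = u (w (x (e (\<sigma> (\<tau> i)))))"
        using \<Phi>[OF fg(1,3) \<tau>i comp_mem[OF iu(2) w(1)]] x e[OF \<sigma>\<tau>i] by simp
      \<comment> \<open>Commutativity of Q exchanges w and x.\<close>
      also have "\<dots> = \<Phi> (h, \<sigma> \<circ> \<tau>) p"
        using 1 x(3)[OF maps_to[OF w(1) e[OF \<sigma>\<tau>i]]] comm_apply[OF w(1) x(1)] by simp
      finally show ?thesis by simp
    qed (simp add: \<Phi>_out)
    then show "\<Phi> (x \<otimes>\<^bsub>W\<^esub> y) = \<Phi> x \<otimes>\<^bsub>perm_group A\<^esub> \<Phi> y"
      unfolding h unfolding xy perm_group_simps by (rule ext)
  qed
  have inj: "inj_on \<Phi> (carrier W)"
  proof (rule inj_onI)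
    fix x y assume xyW: "x \<in> carrier W" "y \<in> carrier W" and eq: "\<Phi> x = \<Phi> y"
    obtain f \<sigma> g \<tau> where xy: "x = (f, \<sigma>)" "y = (g, \<tau>)" by (meson surj_pair)
    then have fg: "f \<in> {1..r} \<rightarrow>\<^sub>E rcosets\<^bsub>G\<^esub> K" "g \<in> {1..r} \<rightarrow>\<^sub>E rcosets\<^bsub>G\<^esub> K"
        "\<sigma> permutes {1..r}" "\<tau> permutes {1..r}"
      using xyW by (auto simp: carrier_W)
    have \<sigma>\<tau>: "\<sigma> i = \<tau> i" and fg': "f (\<sigma> i) = g (\<sigma> i)" if i: "i \<in> {1..r}" for i
    proof -
      have eq': "act (f (\<sigma> i)) (e (\<sigma> i)) = act (g (\<tau> i)) (e (\<tau> i))"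
        using \<Phi>[OF fg(1,3) i id_mem] \<Phi>[OF fg(2,4) i id_mem] eq xy by simp
      then show st: "\<sigma> i = \<tau> i"
        using target(2,3)[OF fg(1,3) i] target(2,3)[OF fg(2,4) i] e_unique by metis
      show "f (\<sigma> i) = g (\<sigma> i)"
        using act_eqD[OF PiE_mem[OF fg(1)] PiE_mem[OF fg(2)] e] target(2)[OF fg(1,3) i] eq' st by metis
    qed
    have "\<sigma> = \<tau>"
      using \<sigma>\<tau> permutes_not_in[OF fg(3)] permutes_not_in[OF fg(4)] by (metis ext)
    moreover have "f = g"
    proof (rule PiE_ext[OF fg(1,2)])
      fix j assume "j \<in> {1..r}"
      then obtain i where "i \<in> {1..r}" "j = \<sigma> i"
        using permutes_image[OF fg(3)] by (metis imageE)
      then show "f j = g j" using fg' by simp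
    qed
    ultimately show "x = y" using xy by simp
  qed
  have surj: "g \<in> \<Phi> ` carrier W" if "g \<in> A" for g
  proof -
    have g: "g permutes P" "\<And>u p. u \<in> Q \<Longrightarrow> p \<in> P \<Longrightarrow> g (u p) = u (g p)"
      using that by (auto simp: A_def)
    have gP: "g p \<in> P" if "p \<in> P" for p
      using permutes_in_image[OF g(1)] that by simp
    have "\<exists>j u. j \<in> {1..r} \<and> u \<in> Q \<and> g (e i) = u (e j)" if "i \<in> {1..r}" for i
      using e_ex[OF gP[OF e[OF that]]] by blast
    \<comment> \<open>Wreath coordinates are read off from g: it moves orbit i to orbit \<sigma>0 i,
      and w i locates the image of e i there.\<close>
    then obtain \<sigma>0 w where \<sigma>0: "\<And>i. i \<in> {1..r} \<Longrightarrow> \<sigma>0 i \<in> {1..r} \<and> w i \<in> Q \<and> g (e i) = w i (e (\<sigma>0 i))"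
      by metis
    define \<sigma> where "\<sigma> = (\<lambda>i. if i \<in> {1..r} then \<sigma>0 i else i)"
    have "inj_on \<sigma>0 {1..r}"
    proof (rule inj_onI)
      fix i j assume ij: "i \<in> {1..r}" "j \<in> {1..r}" "\<sigma>0 i = \<sigma>0 j"
      \<comment> \<open>Equivariance yields the preimages of representatives. If \<sigma>0 i =
        \<sigma>0 j, these preimages coincide although they lie in the orbits i and j.\<close>
      have "g ((inv' (w i)) (e i)) = e (\<sigma>0 i)" "g ((inv' (w j)) (e j)) = e (\<sigma>0 j)"
        using \<sigma>0 ij e inv_mem g(2) by auto
      then have "(inv' (w i)) (e i) = (inv' (w j)) (e j)"
        using ij permutes_inj[OF g(1)] by (metis inj_eq)
      then show "i = j"
        using e_unique ij \<sigma>0 inv_mem by metis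
    qed
    moreover have "\<sigma>0 ` {1..r} \<subseteq> {1..r}"
      using \<sigma>0 by blast
    ultimately have "bij_betw \<sigma>0 {1..r} {1..r}"
      by (simp add: bij_betw_def endo_inj_surj)
    then have "bij_betw \<sigma> {1..r} {1..r}"
      by (subst bij_betw_cong[of _ _ \<sigma>0]) (simp_all add: \<sigma>_def)
    then have \<sigma>: "\<sigma> permutes {1..r}"
      by (rule bij_imp_permutes) (auto simp: \<sigma>_def)
    \<comment> \<open>Coordinates are indexed by target orbits while w is indexed by source orbits,
      hence the inverse of \<sigma>.\<close>
    define f where "f = (\<lambda>j\<in>{1..r}. {v \<in> Q. v (e j) = w (inv' \<sigma> j) (e j)})"
    have "{v \<in> Q. v (e j) = w (inv' \<sigma> j) (e j)} \<in> rcosets\<^bsub>G\<^esub> K" if "j \<in> {1..r}" for j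
    proof -
      have "inv' \<sigma> j \<in> {1..r}"
        using permutes_in_image[OF permutes_inv[OF \<sigma>]] that by blast
      then show ?thesis
        using rcosets_mem[OF _ e[OF that]] \<sigma>0 by blast
    qed
    then have f: "f \<in> {1..r} \<rightarrow>\<^sub>E rcosets\<^bsub>G\<^esub> K"
      by (simp add: f_def)
    have "\<Phi> (f, \<sigma>) p = g p" for p
    proof (cases "p \<in> P")
      case True
      then obtain i u where iu: "i \<in> {1..r}" "u \<in> Q" "p = u (e i)"
        using e_ex by metis
      have \<sigma>i: "\<sigma> i \<in> {1..r}" "\<sigma> i = \<sigma>0 i"
        using \<sigma>0 iu by (auto simp: \<sigma>_def)
      have "w i \<in> f (\<sigma> i)"
        using \<sigma>i(1) iu \<sigma>0[OF iu(1)] permutes_inverses(2)[OF \<sigma>] by (simp add: f_def)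
      then have "act (f (\<sigma> i)) (e (\<sigma> i)) = w i (e (\<sigma> i))"
        using act_eq[OF PiE_mem[OF f \<sigma>i(1)] _ e[OF \<sigma>i(1)]] by simp
      then show ?thesis
        using \<Phi>[OF f \<sigma> iu(1,2)] \<sigma>0[OF iu(1)] g(2)[OF iu(2) e[OF iu(1)]] iu(3) \<sigma>i(2) by simp
    qed (use permutes_not_in[OF g(1)] \<Phi>_out in simp)
    then have "g = \<Phi> (f, \<sigma>)" by auto
    then show ?thesis
      using f \<sigma> by (auto simp: carrier_W)
  qed
  have "bij_betw \<Phi> (carrier W) A"
    using inj surj \<Phi>_mem by (auto simp: bij_betw_def carrier_W)
  then have "W \<cong> perm_group A"
    using hom by (auto simp: is_iso_def iso_def)
  then have "perm_group A \<cong> W"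
    using closed by (rule iso_sym_closed)
  then show ?thesis
    by (simp add: W_def A_def Weyl_group_eq card_orbs r_def)
qed

end

section \<open>Eventual translations\<close>

text \<open>Two natural offsets replace the integer shift b - a and avoid truncation. Source and
  target ray may differ, because the bijection straightening the fixed points renames rays.\<close>

definition translates :: "(nat \<times> nat \<Rightarrow> nat \<times> nat) \<Rightarrow> nat \<Rightarrow> nat \<Rightarrow> bool" where
  "translates h x y \<longleftrightarrow> (\<exists>a b. \<forall>i. h (a + i, x) = (b + i, y))"

lemma translatesI_eventually:
  assumes "\<forall>\<^sub>F i in sequentially. h (i + a, x) = (i + b, y)"
  shows "translates h x y"
proof -
  obtain N where N: "\<And>i. i \<ge> N \<Longrightarrow> h (i + a, x) = (i + b, y)"
    using assms by (auto simp: eventually_sequentially)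
  have "h (N + a + i, x) = (N + b + i, y)" for i
    using N[of "N + i"] by (simp add: ac_simps)
  then show ?thesis unfolding translates_def by blast
qed

lemma eventually_from:
  assumes "\<And>i. P (a + i)"
  shows "eventually P sequentially"
  unfolding eventually_sequentially using assms by (metis le_add_diff_inverse)

lemma translates_id: "translates id x x"
  unfolding translates_def by auto

lemma translates_eq_id: "\<forall>\<^sub>F i in sequentially. h (i, x) = (i, x) \<Longrightarrow> translates h x x"
  using translatesI_eventually[of h 0 x 0 x] by simp

lemma translates_cong:
  assumes "translates h x y" "\<forall>\<^sub>F i in sequentially. g (i, x) = h (i, x)"
  shows "translates g x y"
proof -
  obtain a b where ab: "\<And>i. h (a + i, x) = (b + i, y)"
    using assms(1) by (auto simp: translates_def)
  have "\<forall>\<^sub>F i in sequentially. g (i + a, x) = h (i + a, x)"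
    using assms(2) by (simp add: eventually_sequentially_seg[of "\<lambda>i. g (i, x) = h (i, x)" a])
  then have "\<forall>\<^sub>F i in sequentially. g (i + a, x) = (i + b, y)"
    using ab by (auto elim!: eventually_mono simp: add.commute)
  then show ?thesis by (rule translatesI_eventually)
qed

lemma translates_comp:
  assumes "translates h x y" "translates g y w"
  shows "translates (g \<circ> h) x w"
proof -
  obtain a b a' b' where "\<And>i. h (a + i, x) = (b + i, y)" "\<And>i. g (a' + i, y) = (b' + i, w)"
    using assms by (auto simp: translates_def)
  \<comment> \<open>Starting at a + a' makes h land at b + a' + i, inside the tail on which g
    translates.\<close>
  then have "(g \<circ> h) (a + a' + i, x) = (b + b' + i, w)" for i
    by (simp add: add.assoc) (metis add.left_commute)
  then show ?thesis unfolding translates_def by blast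
qed

text \<open>It is enough that k undoes h far out. An \<open>inv_into\<close> on a set containing
  just a tail of the ray has this property.\<close>

lemma translates_inverse:
  assumes "translates h x y" "\<forall>\<^sub>F i in sequentially. k (h (i, x)) = (i, x)"
  shows "translates k y x"
proof -
  obtain a b where ab: "\<And>i. h (a + i, x) = (b + i, y)"
    using assms(1) by (auto simp: translates_def)
  have "\<forall>\<^sub>F i in sequentially. k (h (i + a, x)) = (i + a, x)"
    using assms(2) by (simp add: eventually_sequentially_seg[of "\<lambda>i. k (h (i, x)) = (i, x)" a])
  then have "\<forall>\<^sub>F i in sequentially. k (i + b, y) = (i + a, x)"
    using ab by (auto elim!: eventually_mono simp: add.commute)
  then show ?thesis by (rule translatesI_eventually)
qed

lemma eventually_translate_iff:
  assumes "\<And>i. h (a + i, x) = (b + i, y)"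
  shows "(\<forall>\<^sub>F i in sequentially. P (h (i, x))) \<longleftrightarrow> (\<forall>\<^sub>F i in sequentially. P (i, y))"
proof -
  have "(\<forall>\<^sub>F i in sequentially. P (h (i, x))) \<longleftrightarrow> (\<forall>\<^sub>F i in sequentially. P (h (i + a, x)))"
    by (rule eventually_sequentially_seg[symmetric])
  also have "\<dots> \<longleftrightarrow> (\<forall>\<^sub>F i in sequentially. P (i + b, y))"
    using assms by (simp add: add.commute)
  also have "\<dots> \<longleftrightarrow> (\<forall>\<^sub>F i in sequentially. P (i, y))"
    by (rule eventually_sequentially_seg)
  finally show ?thesis .
qed

section \<open>Houghton's group via eventual translations\<close>

definition houghton_perms :: "nat \<Rightarrow> (nat \<times> nat \<Rightarrow> nat \<times> nat) set" where
  "houghton_perms n = {h. h permutes rays n \<and> (\<forall>x\<in>{1..n}. translates h x x)}"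

lemma houghton_eq: "houghton n = perm_group (houghton_perms n)"
proof -
  have "(\<exists>(z :: nat \<Rightarrow> nat) (m :: nat \<Rightarrow> int). \<forall>x\<in>{1..n}. \<forall>i\<ge>z x.
            int (fst (h (i, x))) = int i + m x \<and> snd (h (i, x)) = x) \<longleftrightarrow>
        (\<forall>x\<in>{1..n}. translates h x x)" (is "?L = ?R") for h :: "nat \<times> nat \<Rightarrow> nat \<times> nat"
  proof
    assume ?L
    then obtain z and m :: "nat \<Rightarrow> int" where zm: "\<And>x i. x \<in> {1..n} \<Longrightarrow> i \<ge> z x \<Longrightarrow>
        int (fst (h (i, x))) = int i + m x \<and> snd (h (i, x)) = x" by blast
    show ?R
    proof
      fix x assume x: "x \<in> {1..n}"
      \<comment> \<open>The integer under \<open>nat\<close> is the first coordinate of h (z x, x),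
        hence nonnegative, and nothing is truncated.\<close>
      have "h (z x + i, x) = (nat (int (z x) + m x) + i, x)" for i
        using zm[OF x, of "z x"] zm[OF x, of "z x + i"] by (auto simp: prod_eq_iff)
      then show "translates h x x" unfolding translates_def by blast
    qed
  next
    assume ?R
    then obtain a b where "\<And>x i. x \<in> {1..n} \<Longrightarrow> h (a x + i, x) = (b x + i, x)"
      unfolding translates_def by metis
    then have *: "h (i, x) = (b x + (i - a x), x)" if "x \<in> {1..n}" "i \<ge> a x" for x i
      using that by (metis le_add_diff_inverse)
    show ?L
      by (rule exI[of _ a], rule exI[of _ "\<lambda>x. int (b x) - int (a x)"]) (auto simp: *)
  qed
  then show ?thesis
    by (simp add: houghton_def perm_group_def houghton_perms_def)
qed

lemma perms_houghton_perms: "perms (houghton_perms n)"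
proof
  fix g assume g: "g \<in> houghton_perms n"
  then show bij: "bij g"
    by (auto simp: houghton_perms_def permutes_bij)
  have "translates (inv' g) x x" if "x \<in> {1..n}" for x
  proof (rule translates_inverse)
    show "translates g x x" using g that unfolding houghton_perms_def by blast
  qed (simp add: bij_is_inj[OF bij])
  then show "inv' g \<in> houghton_perms n"
    using g by (auto simp: houghton_perms_def permutes_inv)
next
  fix g h assume "g \<in> houghton_perms n" "h \<in> houghton_perms n"
  then show "g \<circ> h \<in> houghton_perms n"
    using translates_comp[of h _ _ g] unfolding houghton_perms_def by (blast intro: permutes_compose)
qed (simp add: houghton_perms_def permutes_id translates_id)

lemma mem_rays_iff: "(i, x) \<in> rays n \<longleftrightarrow> x \<in> {1..n}"
  by (auto simp: rays_def)

lemma houghton_on_eq: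
  assumes "F \<subseteq> rays n"
  shows "houghton_on n F = perm_group (supported (houghton_perms n) F)"
proof -
  have "(\<forall>s\<in>rays n - F. h s = s) \<longleftrightarrow> (\<forall>s. s \<notin> F \<longrightarrow> h s = s)" if "h \<in> houghton_perms n" for h
    using that by (auto simp: houghton_perms_def dest: permutes_not_in)
  then have "{h \<in> houghton_perms n. \<forall>s\<in>rays n - F. h s = s} = supported (houghton_perms n) F"
    by (auto simp: supported_def)
  then show ?thesis
    by (simp add: houghton_on_def houghton_eq)
qed

lemma finite_if_eventually_notin:
  assumes "T \<subseteq> rays n" "\<And>x. x \<in> {1..n} \<Longrightarrow> \<forall>\<^sub>F i in sequentially. (i, x) \<notin> T"
  shows "finite T"
proof -
  obtain N where N: "\<And>x i. x \<in> {1..n} \<Longrightarrow> i \<ge> N x \<Longrightarrow> (i, x) \<notin> T"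
    using assms(2) unfolding eventually_sequentially by metis
  have "T \<subseteq> (\<Union>x\<in>{1..n}. {..<N x} \<times> {x})"
  proof
    fix s assume "s \<in> T"
    then obtain i x where s: "s = (i, x)" "x \<in> {1..n}"
      using assms(1) by (auto simp: rays_def)
    then have "i < N x" using N[OF s(2)] \<open>s \<in> T\<close> by (meson not_le_imp_less)
    then show "s \<in> (\<Union>x\<in>{1..n}. {..<N x} \<times> {x})" using s by auto
  qed
  then show ?thesis by (rule finite_subset) auto
qed

lemma eventually_notin_finite:
  assumes "finite (T :: (nat \<times> nat) set)"
  shows "\<forall>\<^sub>F i in sequentially. (i, x) \<notin> T"
proof -
  have "i \<le> Max (fst ` T)" if "(i, x) \<in> T" for i
    using assms that by (intro Max_ge) force+
  then show ?thesis
    unfolding eventually_sequentially by (metis not_less_eq_eq)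
qed

lemma supported_houghton_perms:
  assumes "F \<subseteq> rays n"
  shows "supported (houghton_perms n) F = {h. h permutes F \<and> (\<forall>x\<in>{1..n}. translates h x x)}"
proof -
  have "h permutes rays n \<and> (\<forall>s. s \<notin> F \<longrightarrow> h s = s) \<longleftrightarrow> h permutes F" for h
    using permutes_superset[of h "rays n" F] permutes_subset[OF _ assms] permutes_not_in[of h F] by blast
  then show ?thesis by (auto simp: supported_def houghton_perms_def)
qed

text \<open>A permutation of a finite set is the identity on some tail of every ray, so the
  translation condition is automatic.\<close>

lemma houghton_perms_finite:
  assumes "F \<subseteq> rays n" "finite F"
  shows "supported (houghton_perms n) F = {h. h permutes F}"
proof -
  have "translates h x x" if "h permutes F" for h x
  proof (rule translates_eq_id)
    show "\<forall>\<^sub>F i in sequentially. h (i, x) = (i, x)"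
      using eventually_notin_finite[OF assms(2), of x] permutes_not_in[OF that]
      by (auto elim!: eventually_mono)
  qed
  then show ?thesis by (auto simp: supported_houghton_perms assms)
qed

text \<open>The tails of the rays meeting \<open>F\<close> go to tails of the standard rays; the finitely many remaining
  points of \<open>F\<close> fill the gap left at the start of one of them.\<close>

lemma straightening:
  assumes F: "F \<subseteq> rays n" and R: "R \<subseteq> {1..n}" "R \<noteq> {}"
    and tails: "\<And>x. x \<in> R \<Longrightarrow> \<forall>\<^sub>F i in sequentially. (i, x) \<in> F"
      "\<And>x. x \<in> {1..n} - R \<Longrightarrow> \<forall>\<^sub>F i in sequentially. (i, x) \<notin> F"
  obtains \<beta> b where "bij_betw \<beta> F (rays (card R))" "bij_betw b R {1..card R}"
    "\<And>x. x \<in> R \<Longrightarrow> translates \<beta> x (b x)"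
proof -
  have finR: "finite R" using R(1) finite_subset by blast
  obtain b where b: "bij_betw b R {1..card R}"
    using ex_bij_betw_nat_finite_1[OF finR] bij_betw_inv by blast
  obtain x0 where x0: "x0 \<in> R" using R by blast
  obtain N where N: "\<And>x i. x \<in> R \<Longrightarrow> i \<ge> N x \<Longrightarrow> (i, x) \<in> F"
    using tails(1) unfolding eventually_sequentially by metis
  define T where "T = {(i, x). x \<in> R \<and> i \<ge> N x}"
  have TF: "T \<subseteq> F" using N by (auto simp: T_def)
  define D where "D = F - T"
  have "finite D"
  proof (rule finite_if_eventually_notin)
    show "D \<subseteq> rays n" using F by (auto simp: D_def)
    fix x assume x: "x \<in> {1..n}"
    show "\<forall>\<^sub>F i in sequentially. (i, x) \<notin> D"
    proof (cases "x \<in> R")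
      case True
      then show ?thesis unfolding eventually_sequentially by (auto simp: D_def T_def)
    next
      case False
      then show ?thesis using tails(2)[of x] x by (auto simp: D_def elim!: eventually_mono)
    qed
  qed
  then obtain d where d: "bij_betw d D {0..<card D}"
    using ex_bij_betw_finite_nat by blast
  \<comment> \<open>The tail sent to the ray b x0 is pushed up by card D, which frees exactly the
    places needed for the points of D.\<close>
  define c where "c x = (if x = x0 then card D else 0)" for x
  define \<beta> where "\<beta> = (\<lambda>s. if s \<in> T then (fst s - N (snd s) + c (snd s), b (snd s)) else (d s, b x0))"
  have "bij_betw \<beta> T {(i, y). y \<in> {1..card R} \<and> i \<ge> c (inv_into R b y)}"
  proof (rule bij_betw_byWitness[where f' = "\<lambda>(i, y). (N (inv_into R b y) + (i - c (inv_into R b y)), inv_into R b y)"])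
    show "\<forall>s\<in>T. (case \<beta> s of (i, y) \<Rightarrow> (N (inv_into R b y) + (i - c (inv_into R b y)), inv_into R b y)) = s"
      using bij_betw_inv_into_left[OF b] by (auto simp: \<beta>_def T_def)
    have 1: "inv_into R b y \<in> R" "b (inv_into R b y) = y" if "y \<in> {1..card R}" for y
      using that bij_betw_inv_into_right[OF b] bij_betw_apply[OF bij_betw_inv_into[OF b]] by auto
    show "\<forall>t\<in>{(i, y). y \<in> {1..card R} \<and> i \<ge> c (inv_into R b y)}.
       \<beta> ((\<lambda>(i, y). (N (inv_into R b y) + (i - c (inv_into R b y)), inv_into R b y)) t) = t"
    proof clarify
      fix i y assume y: "y \<in> {1..card R}" "i \<ge> c (inv_into R b y)"
      define x where "x = inv_into R b y"
      have x: "x \<in> R" "b x = y" "c x \<le> i"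
        using 1[OF y(1)] y(2) by (simp_all add: x_def)
      then have "(N x + (i - c x), x) \<in> T"
        by (simp add: T_def)
      then have "\<beta> (N x + (i - c x), x) = (i, y)"
        using x by (simp add: \<beta>_def)
      then show "\<beta> (N (inv_into R b y) + (i - c (inv_into R b y)), inv_into R b y) = (i, y)"
        by (simp only: x_def)
    qed
    show "(\<lambda>(i, y). (N (inv_into R b y) + (i - c (inv_into R b y)), inv_into R b y)) `
        {(i, y). y \<in> {1..card R} \<and> i \<ge> c (inv_into R b y)} \<subseteq> T"
      using 1 by (auto simp: T_def)
    show "\<beta> ` T \<subseteq> {(i, y). y \<in> {1..card R} \<and> i \<ge> c (inv_into R b y)}"
      using bij_betw_inv_into_left[OF b] bij_betw_apply[OF b] by (fastforce simp: \<beta>_def T_def)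
  qed
  moreover have "bij_betw \<beta> D ({0..<card D} \<times> {b x0})"
  proof -
    have "bij_betw (\<lambda>s. (d s, b x0)) D ({0..<card D} \<times> {b x0})"
      using d by (auto simp: bij_betw_def inj_on_def image_iff)
    then show ?thesis
      by (subst bij_betw_cong[of _ _ "\<lambda>s. (d s, b x0)"]) (auto simp: \<beta>_def D_def)
  qed
  ultimately have "bij_betw \<beta> (T \<union> D)
      ({(i, y). y \<in> {1..card R} \<and> i \<ge> c (inv_into R b y)} \<union> {0..<card D} \<times> {b x0})"
  proof (rule bij_betw_combine)
    show "{(i, y). y \<in> {1..card R} \<and> i \<ge> c (inv_into R b y)} \<inter> ({0..<card D} \<times> {b x0}) = {}"
      using bij_betw_inv_into_left[OF b x0] by (auto simp: c_def)
  qed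
  moreover have "T \<union> D = F" using TF by (auto simp: D_def)
  moreover have "{(i, y). y \<in> {1..card R} \<and> i \<ge> c (inv_into R b y)} \<union> {0..<card D} \<times> {b x0}
      = rays (card R)"
  proof -
    have bx0: "b x0 \<in> {1..card R}" "inv_into R b (b x0) = x0"
      using bij_betw_apply[OF b x0] bij_betw_inv_into_left[OF b x0] by blast+
    have key: "(y \<in> {1..card R} \<and> i \<ge> c (inv_into R b y) \<or> i < card D \<and> y = b x0)
        \<longleftrightarrow> y \<in> {1..card R}" for i y
    proof (cases "y = b x0")
      case True
      then show ?thesis using bx0 by (auto simp: c_def)
    next
      case False
      then have "inv_into R b y \<noteq> x0" if "y \<in> {1..card R}"
        using bij_betw_inv_into_right[OF b that] by metis
      then show ?thesis using False by (auto simp: c_def)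
    qed
    show ?thesis
      by (simp add: set_eq_iff rays_def key del: atLeastAtMost_iff One_nat_def)
  qed
  ultimately have "bij_betw \<beta> F (rays (card R))" by simp
  moreover have "translates \<beta> x (b x)" if "x \<in> R" for x
  proof -
    have "\<beta> (N x + i, x) = (c x + i, b x)" for i
      using that by (simp add: \<beta>_def T_def)
    then show ?thesis unfolding translates_def by blast
  qed
  ultimately show thesis using that b by blast
qed

text \<open>Conjugation by the straightening bijection, which is eventually a translation in both
  directions. Some ray has to absorb the leftover points, so R is nonempty; without rays a finite
  symmetric group appears instead.\<close>

lemma houghton_perms_supported_iso:
  assumes F: "F \<subseteq> rays n" and R: "R \<subseteq> {1..n}" "R \<noteq> {}"
    and tails: "\<And>x. x \<in> R \<Longrightarrow> \<forall>\<^sub>F i in sequentially. (i, x) \<in> F"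
      "\<And>x. x \<in> {1..n} - R \<Longrightarrow> \<forall>\<^sub>F i in sequentially. (i, x) \<notin> F"
  shows "perm_group (supported (houghton_perms n) F) \<cong> houghton (card R)"
proof -
  obtain \<beta> b where \<beta>: "bij_betw \<beta> F (rays (card R))" and b: "bij_betw b R {1..card R}"
    and tr: "\<And>x. x \<in> R \<Longrightarrow> translates \<beta> x (b x)"
    using straightening[OF assms] by blast
  let ?\<gamma> = "inv_into F \<beta>"
  have tr': "translates ?\<gamma> (b x) x" if "x \<in> R" for x
    using tails(1)[OF that]
    by (intro translates_inverse[OF tr[OF that]])
      (auto elim!: eventually_mono simp: bij_betw_inv_into_left[OF \<beta>])
  have "perm_group (supported (houghton_perms n) F) \<cong> perm_group (houghton_perms (card R))"
  proof (rule conjugate_iso[OF \<beta>])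
    fix h assume h: "h \<in> supported (houghton_perms n) F"
    then have h': "h permutes F" "\<And>x. x \<in> {1..n} \<Longrightarrow> translates h x x"
      by (auto simp: supported_houghton_perms[OF F])
    show "h permutes F" by (rule h'(1))
    have "translates (conjugate \<beta> F (rays (card R)) h) y y" if y: "y \<in> {1..card R}" for y
    proof -
      obtain x where x: "x \<in> R" "y = b x"
        using b y by (metis bij_betw_def imageE)
      have "translates (\<beta> \<circ> (h \<circ> ?\<gamma>)) y y"
        using x R tr' tr h'(2) by (auto intro!: translates_comp)
      then show ?thesis
        by (rule translates_cong) (use y in \<open>auto simp: conjugate_def rays_def\<close>)
    qed
    then show "conjugate \<beta> F (rays (card R)) h \<in> houghton_perms (card R)"
      using conjugate_permutes[OF \<beta> h'(1)] by (simp add: houghton_perms_def)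
  next
    fix h assume "h \<in> houghton_perms (card R)"
    then have h: "h permutes rays (card R)" "\<And>x. x \<in> {1..card R} \<Longrightarrow> translates h x x"
      by (auto simp: houghton_perms_def)
    show "h permutes rays (card R)" by (rule h(1))
    have "translates (conjugate ?\<gamma> (rays (card R)) F h) x x" if x: "x \<in> {1..n}" for x
    proof (cases "x \<in> R")
      case True
      \<comment> \<open>The double inverse is known to equal \<beta> on F only, but F contains a
        tail of the ray x.\<close>
      have inv: "\<forall>\<^sub>F i in sequentially. inv_into (rays (card R)) ?\<gamma> (i, x) = \<beta> (i, x)"
        using tails(1)[OF True] by (auto elim!: eventually_mono simp: inv_into_inv_into_eq[OF \<beta>])
      have "translates (?\<gamma> \<circ> (h \<circ> inv_into (rays (card R)) ?\<gamma>)) x x"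
        using tr'[OF True] h(2)[OF bij_betw_apply[OF b True]] translates_cong[OF tr[OF True] inv]
        by (auto intro!: translates_comp)
      then show ?thesis
        by (rule translates_cong) (use tails(1)[OF True] in \<open>auto simp: conjugate_def elim!: eventually_mono\<close>)
    next
      case False
      then show ?thesis
        using tails(2)[of x] x
        by (intro translates_eq_id) (auto simp: conjugate_def elim!: eventually_mono)
    qed
    then show "conjugate ?\<gamma> (rays (card R)) F h \<in> supported (houghton_perms n) F"
      using conjugate_permutes[OF bij_betw_inv_into[OF \<beta>] h(1)]
      by (simp add: supported_houghton_perms[OF F])
  qed
  then show ?thesis by (simp add: houghton_eq)
qed

section \<open>The action of the cyclic group\<close>

locale houghton_element =
  fixes n :: nat and q :: "nat \<times> nat \<Rightarrow> nat \<times> nat"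
  assumes q_mem: "q \<in> houghton_perms n"
begin

definition commutant :: "(nat \<times> nat \<Rightarrow> nat \<times> nat) set" where
  "commutant = {g \<in> houghton_perms n. g \<circ> q = q \<circ> g}"

abbreviation powers :: "(nat \<times> nat \<Rightarrow> nat \<times> nat) set" where
  "powers \<equiv> carrier (cyc n q)"

sublocale H: perms "houghton_perms n"
  by (rule perms_houghton_perms)

lemma centralizer_eq: "centralizer (houghton n) q = perm_group commutant"
  by (simp add: centralizer_def houghton_eq commutant_def)

lemma q_perm: "q permutes rays n"
  using q_mem by (simp add: houghton_perms_def)

lemma q_inj [simp]: "q s = q t \<longleftrightarrow> s = t"
  using permutes_inj[OF q_perm] by (simp add: inj_eq)

lemma pow_inj [simp]: "(q ^^ j) s = (q ^^ j) t \<longleftrightarrow> s = t"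
  by (induction j) auto

lemma bij_pow: "bij (q ^^ j)"
  by (rule bij_fn[OF permutes_bij[OF q_perm]])

lemma commutantD:
  assumes "g \<in> commutant"
  shows "g permutes rays n" "\<And>s. g (q s) = q (g s)" "\<And>x. x \<in> {1..n} \<Longrightarrow> translates g x x"
  using assms by (auto simp: commutant_def houghton_perms_def fun_eq_iff)

lemma commutantI:
  assumes "g permutes rays n" "\<And>s. g (q s) = q (g s)" "\<And>x. x \<in> {1..n} \<Longrightarrow> translates g x x"
  shows "g \<in> commutant"
  using assms by (auto simp: commutant_def houghton_perms_def)

sublocale perms commutant
proof
  fix g assume g: "g \<in> commutant"
  then show "bij g" using H.bij_mem by (auto simp: commutant_def)
  have "inv' g (q s) = q (inv' g s)" for s
  proof -
    have "inv' g (g (q (inv' g s))) = q (inv' g s)"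
      using g H.inv_apply by (auto simp: commutant_def)
    then show ?thesis
      using commutantD(2)[OF g] g H.inv_apply by (auto simp: commutant_def)
  qed
  then show "inv' g \<in> commutant"
    using g H.inv_mem by (auto simp: commutant_def)
next
  fix g h assume gh: "g \<in> commutant" "h \<in> commutant"
  then have "(g \<circ> h) \<circ> q = q \<circ> (g \<circ> h)"
    using commutantD(2)[OF gh(1)] commutantD(2)[OF gh(2)] by (simp add: fun_eq_iff)
  then show "g \<circ> h \<in> commutant"
    using gh H.comp_mem by (simp add: commutant_def)
next
  show "id \<in> commutant"
    using H.id_mem unfolding commutant_def by simp
qed

lemma q_commutant: "q \<in> commutant"
  using q_mem by (simp add: commutant_def)

text \<open>Integer powers are split into iterates and their inverses, so that later arguments need
  only induction over natural exponents.\<close>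

lemma powers_eq: "powers = {q ^^ j |j. True} \<union> {inv' (q ^^ j) |j. True}"
proof -
  interpret G: group "houghton n"
    unfolding houghton_eq by (rule H.group_perm_group)
  have q: "q \<in> carrier (houghton n)"
    using q_mem by (simp add: houghton_eq)
  have pow: "q [^]\<^bsub>houghton n\<^esub> j = q ^^ j" for j :: nat
    by (induction j) (simp_all add: houghton_eq funpow_Suc_right del: funpow.simps(2))
  have mem: "q ^^ j \<in> houghton_perms n" for j
    using G.nat_pow_closed[OF q, of j] unfolding pow by (simp add: houghton_eq)
  have inv: "inv\<^bsub>houghton n\<^esub> (q ^^ j) = inv' (q ^^ j)" for j
    unfolding houghton_eq by (rule H.inv_perm_group[OF mem])
  have "powers = {q [^]\<^bsub>houghton n\<^esub> (k :: int) |k. k \<in> UNIV}"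
    using G.generate_pow[OF q] q by (simp add: cyc_def carrier_subgroup_generated)
  also have "\<dots> = {q ^^ j |j. True} \<union> {inv' (q ^^ j) |j. True}"
  proof (intro equalityI subsetI)
    fix u assume "u \<in> {q [^]\<^bsub>houghton n\<^esub> (k :: int) |k. k \<in> UNIV}"
    then obtain k :: int where "u = q [^]\<^bsub>houghton n\<^esub> k" by blast
    then have "u = q ^^ nat k \<or> u = inv' (q ^^ nat (- k))"
      by (auto simp: int_pow_def2 pow inv)
    then show "u \<in> {q ^^ j |j. True} \<union> {inv' (q ^^ j) |j. True}"
      by blast
  next
    fix u assume "u \<in> {q ^^ j |j. True} \<union> {inv' (q ^^ j) |j. True}"
    then obtain j where "u = q ^^ j \<or> u = inv' (q ^^ j)" by blast
    then have "u = q [^]\<^bsub>houghton n\<^esub> (int j) \<or> u = q [^]\<^bsub>houghton n\<^esub> (- int j)"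
      by (auto simp: int_pow_def2 pow inv)
    then show "u \<in> {q [^]\<^bsub>houghton n\<^esub> (k :: int) |k. k \<in> UNIV}"
      by blast
  qed
  finally show ?thesis .
qed

lemma pow_mem_powers: "q ^^ j \<in> powers"
  by (auto simp: powers_eq)

lemma q_mem_powers: "q \<in> powers"
  using pow_mem_powers[of 1] by simp

lemma powers_subset: "powers \<subseteq> commutant"
proof
  have pow: "q ^^ j \<in> commutant" for j
  proof (induction j)
    case (Suc j)
    show ?case
      unfolding funpow.simps(2) by (rule comp_mem[OF q_commutant Suc])
  qed (use id_mem in \<open>simp add: id_def\<close>)
  fix u assume "u \<in> powers"
  then show "u \<in> commutant"
    by (auto simp: powers_eq pow inv_mem)
qed

lemma pow_apply_commutant: "g \<in> commutant \<Longrightarrow> g ((q ^^ j) s) = (q ^^ j) (g s)"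
  by (induction j) (auto simp: commutantD)

lemma powers_apply_commutant:
  assumes "g \<in> commutant" "u \<in> powers"
  shows "g (u s) = u (g s)"
proof -
  consider j where "u = q ^^ j" | j where "u = inv' (q ^^ j)"
    using assms(2) by (auto simp: powers_eq)
  then show ?thesis
  proof cases
    case (2 j)
    have "(q ^^ j) (g (u s)) = g s"
      using pow_apply_commutant[OF assms(1)] bij_pow 2 by (metis bij_inv_eq_iff)
    then show ?thesis
      using 2 bij_pow by (metis bij_inv_eq_iff)
  qed (use pow_apply_commutant assms in auto)
qed

lemma cyc_simps: "u \<otimes>\<^bsub>cyc n q\<^esub> v = u \<circ> v" "\<one>\<^bsub>cyc n q\<^esub> = id"
  by (simp_all add: cyc_def houghton_eq)

lemma cyc_eq: "cyc n q = perm_group powers"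
  by (simp add: cyc_def subgroup_generated_def houghton_eq perm_group_def)

lemma perms_powers: "perms powers"
proof -
  interpret G: group "houghton n"
    unfolding houghton_eq by (rule H.group_perm_group)
  interpret Q: group "cyc n q"
    unfolding cyc_def by (rule G.group_subgroup_generated)
  show ?thesis
  proof
    fix u assume u: "u \<in> powers"
    have uc: "u \<in> carrier (houghton n)" 
      using u G.carrier_subgroup_generated_subset by (auto simp: cyc_def)
    show "inv' u \<in> powers"
      using Q.inv_closed[OF u] G.inv_subgroup_generated[OF u[unfolded cyc_def]] uc
      by (simp add: cyc_def H.inv_perm_group houghton_eq)
    show "bij u" using u powers_subset bij_mem by blast
  next
    fix u v assume "u \<in> powers" "v \<in> powers"
    then show "u \<circ> v \<in> powers"
      using Q.m_closed[of u v] by (simp add: cyc_simps)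
  qed (use Q.one_closed in \<open>simp add: cyc_simps\<close>)
qed

sublocale Q: perms powers
  by (rule perms_powers)

lemma stab_eq: "stab n q s = {u \<in> powers. u s = s}"
  by (simp add: stabilizer_def)

lemma powers_comm: "u \<in> powers \<Longrightarrow> v \<in> powers \<Longrightarrow> u \<circ> v = v \<circ> u"
  using powers_apply_commutant powers_subset by (auto simp: fun_eq_iff)

text \<open>As g commutes with each power u, u fixes g s exactly when it fixes s. So the centraliser
  preserves every part and does not permute the parts.\<close>

lemma stab_commutant:
  assumes "g \<in> commutant"
  shows "stab n q (g s) = stab n q s"
proof -
  have "u (g s) = g s \<longleftrightarrow> u s = s" if "u \<in> powers" for u
    using powers_apply_commutant[OF assms that, of s] bij_is_inj[OF bij_mem[OF assms]]
    by (metis inj_eq)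
  then show ?thesis
    unfolding stab_eq by blast
qed

section \<open>Fixed, periodic and aperiodic points\<close>

abbreviation fixed :: "(nat \<times> nat) set" where
  "fixed \<equiv> fixed_points n q"

lemma fixed_eq: "fixed = {s \<in> rays n. q s = s}"
proof -
  have "u s = s" if "q s = s" "u \<in> powers" for u s
  proof -
    have "(q ^^ j) s = s" for j
      using that(1) by (induction j) auto
    moreover from this have "inv' (q ^^ j) s = s" for j
      by (rule inv_f_eq[OF bij_is_inj[OF bij_pow]])
    ultimately show ?thesis
      using that(2) unfolding powers_eq by blast
  qed
  then show ?thesis
    unfolding fixed_points_def using q_mem_powers by blast
qed

definition aperiodic :: "(nat \<times> nat) set" where
  "aperiodic = {s \<in> rays n. \<forall>j\<ge>1. (q ^^ j) s \<noteq> s}"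

text \<open>Fixed points are left out because they may fill whole tails; what remains is
  finite.\<close>

definition periodic :: "(nat \<times> nat) set" where
  "periodic = rays n - fixed - aperiodic"

lemma rays_decomp: "rays n = fixed \<union> (aperiodic \<union> periodic)"
  "fixed \<inter> (aperiodic \<union> periodic) = {}" "aperiodic \<inter> periodic = {}"
proof -
  show "rays n = fixed \<union> (aperiodic \<union> periodic)"
    by (auto simp: periodic_def fixed_eq aperiodic_def)
  show "fixed \<inter> (aperiodic \<union> periodic) = {}"
    by (auto simp: periodic_def fixed_eq aperiodic_def dest: spec[of _ 1])
  show "aperiodic \<inter> periodic = {}"
    by (auto simp: periodic_def)
qed

lemma commutant_apply_iff:
  assumes "g \<in> commutant"
  shows "g s \<in> rays n \<longleftrightarrow> s \<in> rays n" "g s \<in> fixed \<longleftrightarrow> s \<in> fixed"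
    "g s \<in> aperiodic \<longleftrightarrow> s \<in> aperiodic" "g s \<in> periodic \<longleftrightarrow> s \<in> periodic"
proof -
  have [simp]: "g s = g t \<longleftrightarrow> s = t" for s t
    using bij_mem[OF assms] by (simp add: bij_is_inj inj_eq)
  show r: "g s \<in> rays n \<longleftrightarrow> s \<in> rays n"
    using commutantD(1)[OF assms] by (rule permutes_in_image)
  show f: "g s \<in> fixed \<longleftrightarrow> s \<in> fixed"
    by (simp add: fixed_eq r flip: commutantD(2)[OF assms])
  show a: "g s \<in> aperiodic \<longleftrightarrow> s \<in> aperiodic"
    by (simp add: aperiodic_def r flip: pow_apply_commutant[OF assms])
  show "g s \<in> periodic \<longleftrightarrow> s \<in> periodic"
    by (simp add: periodic_def r f a)
qed

text \<open>This makes cutting down harmless: far out on each ray, the restriction of g to T is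
  either g or the identity.\<close>

definition tame :: "(nat \<times> nat) set \<Rightarrow> bool" where
  "tame T \<longleftrightarrow> (\<forall>x\<in>{1..n}. (\<forall>\<^sub>F i in sequentially. (i, x) \<in> T) \<or> (\<forall>\<^sub>F i in sequentially. (i, x) \<notin> T))"

lemma tame_finite: "finite T \<Longrightarrow> tame T"
  by (simp add: tame_def eventually_notin_finite)

lemma tame_Diff:
  assumes "tame T" "tame U"
  shows "tame (T - U)"
  unfolding tame_def
proof
  fix x assume x: "x \<in> {1..n}"
  let ?P = "\<lambda>T. \<forall>\<^sub>F i in sequentially. (i, x) \<in> T"
  let ?N = "\<lambda>T. \<forall>\<^sub>F i in sequentially. (i, x) \<notin> T"
  have "?P T \<or> ?N T" "?P U \<or> ?N U"
    using assms x unfolding tame_def by blast+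
  then consider "?P T" "?N U" | "?N T" | "?P U" by blast
  then show "?P (T - U) \<or> ?N (T - U)"
  proof cases
    case 1
    then have "?P (T - U)" by eventually_elim simp
    then show ?thesis ..
  next
    case 2
    then have "?N (T - U)" by eventually_elim simp
    then show ?thesis ..
  next
    case 3
    then have "?N (T - U)" by eventually_elim simp
    then show ?thesis ..
  qed
qed

lemma block_commutantI:
  assumes T: "T \<subseteq> rays n" "tame T" and inv: "\<And>g s. g \<in> commutant \<Longrightarrow> s \<in> T \<Longrightarrow> g s \<in> T"
  shows "block commutant T"
proof -
  have iff: "g s \<in> T \<longleftrightarrow> s \<in> T" if "g \<in> commutant" for g s
    using inv[OF that] inv[OF inv_mem[OF that], of "g s"] inv_apply(1)[OF that, of s] by metis
  have "localize T g \<in> commutant" if g: "g \<in> commutant" for g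
  proof (rule commutantI)
    have "bij_betw g T T"
    proof (rule bij_betw_byWitness[where f' = "inv' g"])
      show "\<forall>s\<in>T. inv' g (g s) = s" "\<forall>s\<in>T. g (inv' g s) = s"
        using g by simp_all
      show "g ` T \<subseteq> T" "inv' g ` T \<subseteq> T"
        using inv[OF g] inv[OF inv_mem[OF g]] by auto
    qed
    then have "bij_betw (localize T g) T T"
      by (subst bij_betw_cong[of _ _ g]) (simp_all add: localize_def)
    then have "localize T g permutes T"
      by (rule bij_imp_permutes) (simp add: localize_def)
    then show "localize T g permutes rays n"
      using T(1) by (rule permutes_subset)
    show "localize T g (q s) = q (localize T g s)" for s
      using iff[OF q_commutant] commutantD(2)[OF g] by (auto simp: localize_def)
    fix x assume x: "x \<in> {1..n}"
    consider "\<forall>\<^sub>F i in sequentially. (i, x) \<in> T" | "\<forall>\<^sub>F i in sequentially. (i, x) \<notin> T"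
      using T(2) x unfolding tame_def by blast
    then show "translates (localize T g) x x"
    proof cases
      case 1
      show ?thesis
        by (rule translates_cong[OF commutantD(3)[OF g x]])
          (use 1 in \<open>auto elim!: eventually_mono simp: localize_def\<close>)
    next
      case 2
      then show ?thesis
        by (intro translates_eq_id) (auto elim!: eventually_mono simp: localize_def)
    qed
  qed
  then show ?thesis
    using inv by (auto simp: block_def)
qed

text \<open>If \<open>b < a\<close> the point itself leaves the tail under \<open>q\<close>, but some later point of the tail is sent
  to it by \<open>q ^^ j\<close>, so injectivity of \<open>q ^^ j\<close> excludes a period.\<close>

lemma translation_aperiodic:
  assumes tr: "\<And>i. q (a + i, x) = (b + i, x)" and "a \<noteq> b" "x \<in> {1..n}"
  shows "(max a b + i, x) \<in> aperiodic"
proof -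
  have "(q ^^ j) (max a b + i, x) \<noteq> (max a b + i, x)" if "j \<ge> 1" for j
  proof (cases "a < b")
    case True
    define d where "d = b - a"
    have b: "b = a + d" using True by (simp add: d_def)
    have "(q ^^ j) (a + k, x) = (a + k + j * d, x)" for k
    proof (induction j)
      case (Suc j)
      have "(q ^^ Suc j) (a + k, x) = q (a + (k + j * d), x)"
        using Suc by (simp add: add.assoc)
      also have "\<dots> = (a + k + Suc j * d, x)"
        unfolding tr b by (simp add: algebra_simps)
      finally show ?case .
    qed simp
    from this[of "d + i"] show ?thesis
      using that True by (auto simp: max_def b add.assoc)
  next
    case False
    define d where "d = a - b"
    have d: "d > 0" "a = b + d" using False assms(2) by (simp_all add: d_def)
    have "(q ^^ j) (b + k + j * d, x) = (b + k, x)" for k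
    proof (induction j)
      case (Suc j)
      have "(q ^^ Suc j) (b + k + Suc j * d, x) = (q ^^ j) (q (a + (k + j * d), x))"
        by (simp add: d funpow_Suc_right algebra_simps del: funpow.simps(2))
      also have "\<dots> = (b + k, x)"
        unfolding tr using Suc by (simp add: add.assoc)
      finally show ?case .
    qed simp
    from this[of "d + i"] have *: "(q ^^ j) (a + i + j * d, x) = (a + i, x)"
      by (simp add: d add.assoc)
    show ?thesis
    proof
      assume "(q ^^ j) (max a b + i, x) = (max a b + i, x)"
      then have "(q ^^ j) (a + i, x) = (q ^^ j) (a + i + j * d, x)"
        using * d by simp
      then have "(a + i, x) = (a + i + j * d, x)"
        unfolding pow_inj .
      then show False using that d by simp
    qed
  qed
  then show ?thesis
    using assms(3) by (simp add: aperiodic_def mem_rays_iff)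
qed

lemma ray_cases:
  assumes "x \<in> {1..n}"
  obtains "\<forall>\<^sub>F i in sequentially. (i, x) \<in> fixed"
  | "\<forall>\<^sub>F i in sequentially. (i, x) \<in> aperiodic"
proof -
  obtain a b where ab: "\<And>i. q (a + i, x) = (b + i, x)"
    using q_mem assms unfolding houghton_perms_def translates_def by blast
  show thesis
  proof (cases "a = b")
    case True
    have "\<forall>\<^sub>F i in sequentially. (i, x) \<in> fixed"
      using ab True assms by (intro eventually_from[of _ a]) (simp add: fixed_eq mem_rays_iff)
    then show thesis by (rule that(1))
  next
    case False
    have "\<forall>\<^sub>F i in sequentially. (i, x) \<in> aperiodic"
      using translation_aperiodic[OF ab False assms] by (rule eventually_from)
    then show thesis by (rule that(2))
  qed
qed

lemma tame_fixed: "tame fixed"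
  unfolding tame_def
proof
  fix x assume "x \<in> {1..n}"
  then show "(\<forall>\<^sub>F i in sequentially. (i, x) \<in> fixed) \<or> (\<forall>\<^sub>F i in sequentially. (i, x) \<notin> fixed)"
  proof (cases x rule: ray_cases)
    case 2
    then have "\<forall>\<^sub>F i in sequentially. (i, x) \<notin> fixed"
      by (rule eventually_mono) (use rays_decomp(2) in blast)
    then show ?thesis ..
  qed blast
qed

lemma tame_aperiodic: "tame aperiodic"
  unfolding tame_def
proof
  fix x assume "x \<in> {1..n}"
  then show "(\<forall>\<^sub>F i in sequentially. (i, x) \<in> aperiodic) \<or> (\<forall>\<^sub>F i in sequentially. (i, x) \<notin> aperiodic)"
  proof (cases x rule: ray_cases)
    case 1
    then have "\<forall>\<^sub>F i in sequentially. (i, x) \<notin> aperiodic"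
      by (rule eventually_mono) (use rays_decomp(2) in blast)
    then show ?thesis ..
  qed blast
qed

lemma finite_periodic: "finite periodic"
proof (rule finite_if_eventually_notin)
  fix x assume "x \<in> {1..n}"
  then show "\<forall>\<^sub>F i in sequentially. (i, x) \<notin> periodic"
    by (cases x rule: ray_cases) (erule eventually_mono, use rays_decomp(2,3) in blast)+
qed (auto simp: periodic_def)

lemma block_fixed: "block commutant fixed"
  by (rule block_commutantI) (use tame_fixed commutant_apply_iff rays_decomp(1) in blast)+

lemma block_aperiodic: "block commutant aperiodic"
  by (rule block_commutantI) (use tame_aperiodic commutant_apply_iff rays_decomp(1) in blast)+

lemma block_periodic: "block commutant periodic"
  by (rule block_commutantI)
    (use tame_finite[OF finite_periodic] commutant_apply_iff rays_decomp(1) in blast)+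

lemma supported_rays: "supported commutant (rays n) = commutant"
  using permutes_not_in[OF commutantD(1)] by (auto simp: supported_def)

text \<open>Commuting with q is no restriction on points that q fixes, so this factor of the
  centraliser is all of \<open>houghton_on\<close>.\<close>

lemma supported_fixed: "supported commutant fixed = supported (houghton_perms n) fixed"
proof -
  have "h \<in> commutant" if h: "h \<in> houghton_perms n" "\<And>s. s \<notin> fixed \<Longrightarrow> h s = s" for h
  proof -
    have "h (q s) = q (h s)" for s
    proof (cases "s \<in> fixed")
      case True
      \<comment> \<open>Otherwise h would fix h s, and injectivity would give h s = s, which does
        lie in \<open>fixed\<close>.\<close>
      have "h s \<in> fixed"
        using h H.inv_apply(1)[OF h(1)] True by metis
      then show ?thesis using True by (simp add: fixed_eq)
    next
      case False
      then have "q s \<notin> fixed"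
        using commutant_apply_iff[OF q_commutant] by simp
      then show ?thesis using h(2) False by simp
    qed
    then show ?thesis
      using h(1) by (auto simp: commutant_def)
  qed
  then show ?thesis
    by (auto simp: supported_def commutant_def)
qed

lemma houghton_on_fixed: "houghton_on n fixed = perm_group (supported commutant fixed)"
proof -
  have "fixed \<subseteq> rays n" using rays_decomp(1) by blast
  then show ?thesis by (simp add: houghton_on_eq supported_fixed)
qed

lemma finite_powers_iff: "finite powers \<longleftrightarrow> (\<exists>j\<ge>1. q ^^ j = id)"
proof
  assume fin: "finite powers"
  have "\<not> inj (\<lambda>j. q ^^ j)"
    using finite_subset[OF _ fin, of "range (\<lambda>j. q ^^ j)"] pow_mem_powers
    by (metis finite_imageD image_subsetI infinite_UNIV_nat)
  then obtain i j where ij: "i < j" "q ^^ i = q ^^ j"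
    by (metis injI linorder_neqE_nat)
  have "q ^^ (j - i) = id"
  proof
    fix s
    have "(q ^^ i) ((q ^^ (j - i)) s) = (q ^^ i) s"
      using ij by (metis funpow_add le_add_diff_inverse less_imp_le comp_apply)
    then show "(q ^^ (j - i)) s = id s" by simp
  qed
  then show "\<exists>j\<ge>1. q ^^ j = id"
    using ij by (intro exI[of _ "j - i"]) simp
next
  assume "\<exists>j\<ge>1. q ^^ j = id"
  then obtain j where j: "j \<ge> 1" "q ^^ j = id" by blast
  have "q ^^ i = q ^^ (i mod j)" for i
    using funpow_mod_eq[of j q _ i] j by (auto simp: fun_eq_iff)
  then have "q ^^ i \<in> (\<lambda>i. q ^^ i) ` {..<j}" for i
    using j(1) by (intro image_eqI[of _ _ "i mod j"]) simp_all
  then have "powers \<subseteq> (\<lambda>i. q ^^ i) ` {..<j} \<union> inv' ` (\<lambda>i. q ^^ i) ` {..<j}"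
    unfolding powers_eq by blast
  then show "finite powers"
    by (rule finite_subset) simp
qed

lemma aperiodic_empty:
  assumes "finite powers"
  shows "aperiodic = {}"
  using assms by (auto simp: finite_powers_iff aperiodic_def)

text \<open>Without aperiodic points every power of q moves only the finitely many points of
  \<open>periodic\<close>, which leaves room for finitely many powers only.\<close>

lemma aperiodic_nonempty:
  assumes "infinite powers"
  shows "aperiodic \<noteq> {}"
proof
  assume "aperiodic = {}"
  then have fx: "s \<in> fixed" if "s \<in> rays n - periodic" for s
    using that rays_decomp(1) by blast
  have "u permutes periodic" if "u \<in> powers" for u
  proof (rule permutes_superset)
    show "u permutes rays n"
      using that powers_subset commutantD(1) by blast
    show "u s = s" if "s \<in> rays n - periodic" for s
      using fx[OF that] \<open>u \<in> powers\<close> unfolding fixed_points_def by blast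
  qed
  then have "powers \<subseteq> {u. u permutes periodic}" by blast
  then show False
    using assms finite_permutations[OF finite_periodic] finite_subset by blast
qed

section \<open>Components of the aperiodic part\<close>

lemma aperiodicD: "s \<in> aperiodic \<Longrightarrow> q s \<noteq> s"
  using rays_decomp(1,2) unfolding fixed_eq by blast

text \<open>The equivalence makes T invariant under the inverse of q as well, so that differences of
  admissible sets are admissible.\<close>

definition admissible :: "(nat \<times> nat) set \<Rightarrow> bool" where
  "admissible T \<longleftrightarrow> T \<subseteq> aperiodic \<and> tame T \<and> (\<forall>s. q s \<in> T \<longleftrightarrow> s \<in> T)"

definition ends :: "(nat \<times> nat) set \<Rightarrow> nat set" where
  "ends T = {x \<in> {1..n}. \<forall>\<^sub>F i in sequentially. (i, x) \<in> T}"

lemma admissibleD: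
  assumes "admissible T"
  shows "T \<subseteq> aperiodic" "tame T" "q s \<in> T \<longleftrightarrow> s \<in> T"
  using assms unfolding admissible_def by blast+

lemma not_endsD:
  assumes "admissible T" "x \<in> {1..n} - ends T"
  shows "\<forall>\<^sub>F i in sequentially. (i, x) \<notin> T"
  using assms by (auto simp: admissible_def tame_def ends_def)

lemma finite_ends: "finite (ends T)"
  by (simp add: ends_def)

lemma ends_mono: "T \<subseteq> U \<Longrightarrow> ends T \<subseteq> ends U"
  by (auto simp: ends_def elim: eventually_mono)

lemma ends_Int: "ends (T \<inter> U) = ends T \<inter> ends U"
  by (auto simp: ends_def eventually_conj_iff)

lemma ends_empty: "ends {} = {}"
  by (simp add: ends_def)

lemma ends_Diff:
  assumes "ends T \<subseteq> ends U"
  shows "ends (T - U) = {}"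
proof -
  have "ends (T - U) \<subseteq> ends U" "ends (T - U) \<inter> ends U = ends {}"
    using ends_mono[of "T - U" T] assms ends_Int[of "T - U" U] by (blast, metis Diff_disjoint Int_Diff inf_commute)
  then show ?thesis using ends_empty by blast
qed

lemma admissible_aperiodic: "admissible aperiodic"
  using tame_aperiodic commutant_apply_iff[OF q_commutant] by (simp add: admissible_def)

lemma admissible_Diff: "admissible T \<Longrightarrow> admissible U \<Longrightarrow> admissible (T - U)"
  by (auto simp: admissible_def tame_Diff)

lemma admissible_rays: "admissible T \<Longrightarrow> T \<subseteq> rays n"
  using rays_decomp(1) by (auto simp: admissible_def)

text \<open>Without ends T is finite, and the iterates of q on a point of a finite invariant set
  must repeat, contrary to aperiodicity.\<close>

lemma admissible_no_ends:
  assumes "admissible T" "ends T = {}"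
  shows "T = {}"
proof (rule ccontr)
  assume "T \<noteq> {}"
  then obtain s where s: "s \<in> T" by blast
  have "finite T"
    using admissible_rays[OF assms(1)] not_endsD[OF assms(1)] assms(2)
    by (intro finite_if_eventually_notin) auto
  moreover have "(q ^^ j) s \<in> T" for j
    using s by (induction j) (simp_all add: admissibleD(3)[OF assms(1)])
  ultimately have "\<not> inj (\<lambda>j. (q ^^ j) s)"
    using finite_subset[of "range (\<lambda>j. (q ^^ j) s)" T] by (auto dest: finite_imageD)
  then obtain k l where "k \<noteq> l" "(q ^^ k) s = (q ^^ l) s"
    by (auto simp: inj_def)
  then obtain i j where ij: "i < j" "(q ^^ i) s = (q ^^ j) s"
    by (cases k l rule: linorder_cases) auto
  then have "(q ^^ i) ((q ^^ (j - i)) s) = (q ^^ i) s"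
    by (metis funpow_add le_add_diff_inverse less_imp_le comp_apply)
  then have "(q ^^ (j - i)) s = s" by simp
  moreover have "s \<in> aperiodic" using s assms(1) by (auto simp: admissible_def)
  ultimately show False
    using ij(1) by (auto simp: aperiodic_def)
qed

text \<open>The difference T - U is admissible and has no ends, so it is empty.\<close>

lemma admissible_le:
  assumes "admissible T" "admissible U" "ends T \<subseteq> ends U"
  shows "T \<subseteq> U"
  using admissible_no_ends[OF admissible_Diff[OF assms(1,2)] ends_Diff[OF assms(3)]] by blast

lemma ends_aperiodic_iff:
  assumes "x \<in> {1..n}"
  shows "x \<in> ends aperiodic \<longleftrightarrow> \<not> (\<forall>\<^sub>F i in sequentially. (i, x) \<in> fixed)"
proof -
  have "\<not> ((\<forall>\<^sub>F i in sequentially. (i, x) \<in> fixed) \<and> (\<forall>\<^sub>F i in sequentially. (i, x) \<in> aperiodic))"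
  proof
    assume "(\<forall>\<^sub>F i in sequentially. (i, x) \<in> fixed) \<and> (\<forall>\<^sub>F i in sequentially. (i, x) \<in> aperiodic)"
    then have "\<forall>\<^sub>F i in sequentially. (i, x) \<in> fixed \<inter> aperiodic"
      by (simp add: eventually_conj_iff)
    moreover have "fixed \<inter> aperiodic = {}" using rays_decomp(2) by blast
    ultimately show False by simp
  qed
  then show ?thesis
    using ray_cases[OF assms] assms unfolding ends_def by blast
qed

text \<open>Counting the points outside a tail before and after applying \<open>q\<close> shows that a non-empty
  admissible set cannot run along a single ray.\<close>

lemma two_ends:
  assumes T: "admissible T" "T \<noteq> {}"
  shows "card (ends T) \<ge> 2"
proof (rule ccontr)
  assume "\<not> card (ends T) \<ge> 2"
  moreover have "card (ends T) \<noteq> 0"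
    using admissible_no_ends T finite_ends by auto
  ultimately have "card (ends T) = 1" by linarith
  then obtain x where x: "ends T = {x}"
    by (auto simp: card_1_singleton_iff)
  then have xn: "x \<in> {1..n}" by (auto simp: ends_def)
  obtain a b where ab: "\<And>i. q (a + i, x) = (b + i, x)"
    using q_mem xn unfolding houghton_perms_def translates_def by blast
  obtain c where c: "\<And>i. i \<ge> c \<Longrightarrow> (i, x) \<in> T"
    using x by (auto simp: ends_def eventually_sequentially)
  have qT: "q s \<in> T \<longleftrightarrow> s \<in> T" for s by (rule admissibleD(3)[OF T(1)])
  define L where "L m = range (\<lambda>i. (m + i, x))" for m :: nat
  have L_iff: "(i, y) \<in> L m \<longleftrightarrow> y = x \<and> i \<ge> m" for i y m
    by (auto simp: L_def image_iff intro: le_Suc_ex)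
  have fin: "finite (T - L m)" for m
  proof (rule finite_if_eventually_notin)
    show "T - L m \<subseteq> rays n" using admissible_rays[OF T(1)] by blast
    fix y assume y: "y \<in> {1..n}"
    show "\<forall>\<^sub>F i in sequentially. (i, y) \<notin> T - L m"
    proof (cases "y = x")
      case True
      then show ?thesis unfolding eventually_sequentially by (auto simp: L_iff)
    next
      case False
      then have "\<forall>\<^sub>F i in sequentially. (i, y) \<notin> T"
        using not_endsD[OF T(1), of y] x y by simp
      then show ?thesis by (rule eventually_mono) simp
    qed
  qed
  \<comment> \<open>q maps T onto itself and the tail L (a + c) onto L (b + c), so the complements
    of these tails in T are equally large. Adding c keeps both tails inside T.\<close>
  have "q ` (T - L (a + c)) = T - L (b + c)"
  proof -
    have "q ` L (a + c) = L (b + c)"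
      unfolding L_def image_image add.assoc ab ..
    moreover have "q ` T = T"
    proof (intro equalityI subsetI)
      fix t assume t: "t \<in> T"
      obtain s where "t = q s"
        using permutes_surj[OF q_perm] by (metis surjD)
      then show "t \<in> q ` T" using t qT by blast
    qed (use qT in blast)
    moreover have "q ` (T - L (a + c)) = q ` T - q ` L (a + c)"
      using permutes_inj[OF q_perm] by (rule image_set_diff)
    ultimately show ?thesis by simp
  qed
  then have card_eq: "card (T - L (a + c)) = card (T - L (b + c))"
    using card_image[OF inj_on_subset[OF permutes_inj[OF q_perm]], of "T - L (a + c)"] by simp
  \<comment> \<open>A longer tail leaves strictly fewer points of T, so equal sizes force a = b, and
    then q fixes a point of T.\<close>
  have strict: "card (T - L (u + c)) < card (T - L (v + c))" if "u < v" for u v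
  proof (rule psubset_card_mono[OF fin])
    have "(u + c, x) \<in> T - L (v + c)" "(u + c, x) \<notin> T - L (u + c)"
      using that c by (auto simp: L_iff)
    moreover have "L (v + c) \<subseteq> L (u + c)" using that by (auto simp: L_iff)
    ultimately show "T - L (u + c) \<subset> T - L (v + c)" by blast
  qed
  have "a = b"
    using strict[of a b] strict[of b a] card_eq by (cases a b rule: linorder_cases) auto
  then have "q (a + c, x) = (a + c, x)" using ab by simp
  moreover have "(a + c, x) \<in> aperiodic"
    using c[of "a + c"] T(1) by (auto simp: admissible_def)
  ultimately show False
    using aperiodicD by blast
qed

text \<open>The image is admissible because g commutes with q, and it has the ends of T because g
  translates along each ray; \<open>admissible_le\<close> then applies in both directions.\<close>

lemma admissible_commutant:
  assumes T: "admissible T" and g: "g \<in> commutant"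
  shows "g ` T = T"
proof -
  have ev: "(\<forall>\<^sub>F i in sequentially. (i, x) \<in> g ` T) \<longleftrightarrow> (\<forall>\<^sub>F i in sequentially. (i, x) \<in> T)"
    "(\<forall>\<^sub>F i in sequentially. (i, x) \<notin> g ` T) \<longleftrightarrow> (\<forall>\<^sub>F i in sequentially. (i, x) \<notin> T)"
    if x: "x \<in> {1..n}" for x
  proof -
    obtain a b where ab: "\<And>i. g (a + i, x) = (b + i, x)"
      using commutantD(3)[OF g x] by (auto simp: translates_def)
    have iff: "g s \<in> g ` T \<longleftrightarrow> s \<in> T" for s
      using bij_is_inj[OF bij_mem[OF g]] by (rule inj_image_mem_iff)
    show "(\<forall>\<^sub>F i in sequentially. (i, x) \<in> g ` T) \<longleftrightarrow> (\<forall>\<^sub>F i in sequentially. (i, x) \<in> T)"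
      using eventually_translate_iff[of g a x b x "\<lambda>s. s \<in> g ` T", OF ab] by (simp only: iff)
    show "(\<forall>\<^sub>F i in sequentially. (i, x) \<notin> g ` T) \<longleftrightarrow> (\<forall>\<^sub>F i in sequentially. (i, x) \<notin> T)"
      using eventually_translate_iff[of g a x b x "\<lambda>s. s \<notin> g ` T", OF ab] by (simp only: iff)
  qed
  have "admissible (g ` T)"
    unfolding admissible_def
  proof (intro conjI allI)
    show "g ` T \<subseteq> aperiodic"
      using T commutant_apply_iff(3)[OF g] by (auto simp: admissible_def)
    show "tame (g ` T)"
      using T ev by (simp add: admissible_def tame_def)
    fix s
    obtain t where s: "s = g t" using bij_is_surj[OF bij_mem[OF g]] by (metis surjD)
    have iff: "g s \<in> g ` T \<longleftrightarrow> s \<in> T" for s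
      using bij_is_inj[OF bij_mem[OF g]] by (rule inj_image_mem_iff)
    have "q s \<in> g ` T \<longleftrightarrow> g (q t) \<in> g ` T"
      by (simp add: s commutantD(2)[OF g])
    also have "\<dots> \<longleftrightarrow> s \<in> g ` T"
      unfolding s iff by (rule admissibleD(3)[OF T])
    finally show "q s \<in> g ` T \<longleftrightarrow> s \<in> g ` T" .
  qed
  moreover have "ends (g ` T) = ends T"
    using ev by (auto simp: ends_def)
  ultimately show ?thesis
    using T admissible_le by (metis order_antisym order_refl)
qed

lemma block_admissible:
  assumes "admissible T"
  shows "block commutant T"
  by (rule block_commutantI)
    (use admissible_rays admissibleD(2) admissible_commutant assms in blast)+

text \<open>These are the atoms among the admissible sets.\<close>

definition component :: "(nat \<times> nat) set \<Rightarrow> bool" where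
  "component T \<longleftrightarrow> admissible T \<and> T \<noteq> {} \<and> (\<forall>U. admissible U \<longrightarrow> U \<subseteq> T \<longrightarrow> U \<noteq> {} \<longrightarrow> U = T)"

text \<open>Among the admissible sets containing s, one with the fewest ends is minimal even among
  all nonempty admissible sets.\<close>

lemma component_ex:
  assumes "s \<in> aperiodic"
  shows "\<exists>T. component T \<and> s \<in> T"
proof -
  obtain T where T: "admissible T" "s \<in> T"
    and min: "\<And>U. admissible U \<Longrightarrow> s \<in> U \<Longrightarrow> card (ends T) \<le> card (ends U)"
    using ex_has_least_nat[of "\<lambda>T. admissible T \<and> s \<in> T" aperiodic "\<lambda>T. card (ends T)"]
      assms admissible_aperiodic by blast
  have eq: "U = T" if U: "admissible U" "s \<in> U" "U \<subseteq> T" for U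
  proof -
    have "ends U = ends T"
      using ends_mono[OF U(3)] min[OF U(1,2)] finite_ends by (metis card_seteq)
    then show ?thesis
      using admissible_le[OF T(1) U(1)] U(3) by simp
  qed
  have "U = T" if U: "admissible U" "U \<subseteq> T" "U \<noteq> {}" for U
  proof (cases "s \<in> U")
    case False
    \<comment> \<open>If U misses s, then T - U contains s and by the choice of T is all of
      T.\<close>
    then have "T - U = T"
      using eq[OF admissible_Diff[OF T(1) U(1)]] T(2) by blast
    then show ?thesis using U by blast
  qed (use eq U in blast)
  then show ?thesis
    using T unfolding component_def by blast
qed

lemma component_subset:
  assumes "component T" "admissible U" "T \<inter> U \<noteq> {}"
  shows "T \<subseteq> U"
proof -
  have "admissible (T - U)" "T - U \<noteq> T"
    using assms admissible_Diff by (auto simp: component_def)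
  then have "T - U = {}"
    using assms(1) unfolding component_def by blast
  then show ?thesis by blast
qed

lemma component_disjoint: "component T \<Longrightarrow> component U \<Longrightarrow> T \<noteq> U \<Longrightarrow> T \<inter> U = {}"
  using component_subset unfolding component_def by (metis inf_commute order_antisym)

lemma Union_component: "\<Union>(Collect component) = aperiodic"
  using component_ex by (auto simp: component_def admissible_def)

lemma ends_component_disjoint:
  assumes "component T" "component U" "T \<noteq> U"
  shows "ends T \<inter> ends U = {}"
  using component_disjoint[OF assms] ends_Int[of T U] ends_empty by simp

lemma finite_component: "finite (Collect component)"
proof (rule finite_imageD)
  show "finite (ends ` Collect component)"
    by (rule finite_subset[of _ "Pow {1..n}"]) (auto simp: ends_def)
  show "inj_on ends (Collect component)"
    using admissible_le by (auto simp: inj_on_def component_def)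
qed

lemma card_component: "2 * card (Collect component) \<le> card (ends aperiodic)"
proof -
  have "2 * card (Collect component) \<le> (\<Sum>T\<in>Collect component. card (ends T))"
    using sum_mono[of "Collect component" "\<lambda>_. 2" "\<lambda>T. card (ends T)"] two_ends
    by (simp add: component_def mult.commute)
  also have "\<dots> = card (\<Union>T\<in>Collect component. ends T)"
    using ends_component_disjoint
    by (intro card_UN_disjoint[symmetric]) (auto simp: finite_component finite_ends)
  also have "\<dots> \<le> card (ends aperiodic)"
  proof (rule card_mono[OF finite_ends])
    show "(\<Union>T\<in>Collect component. ends T) \<subseteq> ends aperiodic"
      using ends_mono by (auto simp: component_def admissible_def subset_iff)
  qed
  finally show ?thesis .
qed

text \<open>The translation length on the ray x; \<open>shift_eq\<close> shows that it does not
  depend on the offsets.\<close>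

definition shift :: "nat \<Rightarrow> (nat \<times> nat \<Rightarrow> nat \<times> nat) \<Rightarrow> int" where
  "shift x g = (THE m. \<exists>a b. (\<forall>i. g (a + i, x) = (b + i, x)) \<and> m = int b - int a)"

lemma shift_eq:
  assumes "\<And>i. g (a + i, x) = (b + i, x)"
  shows "shift x g = int b - int a"
  unfolding shift_def
proof (rule the_equality)
  fix m assume "\<exists>a b. (\<forall>i. g (a + i, x) = (b + i, x)) \<and> m = int b - int a"
  then obtain a' b' where ab: "\<And>i. g (a' + i, x) = (b' + i, x)" "m = int b' - int a'" by blast
  have "(b + a', x) = (b' + a, x)"
    using assms[of a'] ab(1)[of a] by (simp add: add.commute)
  then show "m = int b - int a" using ab(2) by simp
qed (use assms in blast)

text \<open>The fixed points of an element of the centraliser supported on a component form an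
  admissible set, so they are everything as soon as they contain a tail.\<close>

lemma component_iso_integer:
  assumes T: "component T"
  shows "perm_group (supported commutant T) \<cong> integer_group"
proof -
  interpret S: perms "supported commutant T" by (rule perms_supported)
  have adm: "admissible T" "T \<noteq> {}" using T by (auto simp: component_def)
  obtain x where x: "x \<in> ends T" using two_ends[OF adm] by fastforce
  then have xn: "x \<in> {1..n}" by (simp add: ends_def)
  have tr: "\<exists>a b. \<forall>i. g (a + i, y) = (b + i, y)" if "g \<in> supported commutant T" "y \<in> {1..n}" for g y
    using that commutantD(3) by (simp add: supported_def translates_def)
  have hom: "shift x \<in> hom (perm_group (supported commutant T)) integer_group"
  proof (rule homI)
    fix g h assume gh: "g \<in> carrier (perm_group (supported commutant T))"
      "h \<in> carrier (perm_group (supported commutant T))"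
    then obtain a b a' b' where ab: "\<And>i. g (a + i, x) = (b + i, x)" "\<And>i. h (a' + i, x) = (b' + i, x)"
      using tr xn by (metis perm_group_simps(1))
    have "(g \<circ> h) (a' + a + i, x) = (b + b' + i, x)" for i
      using ab(1)[of "b' + i"] ab(2)[of "a + i"] by (simp add: ac_simps)
    then have "shift x (g \<circ> h) = int (b + b') - int (a' + a)" by (rule shift_eq)
    then show "shift x (g \<otimes>\<^bsub>perm_group (supported commutant T)\<^esub> h) =
        shift x g \<otimes>\<^bsub>integer_group\<^esub> shift x h"
      using shift_eq[of g, OF ab(1)] shift_eq[of h, OF ab(2)] by simp
  qed simp
  have ker: "g = id" if g: "g \<in> supported commutant T" and 0: "shift x g = 0" for g
  proof -
    define U where "U = {s \<in> T. g s = s}"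
    have gc: "g \<in> commutant" using g by (simp add: supported_def)
    \<comment> \<open>On a translated tail either all points are fixed or, if the offsets differ,
      none is. This makes U tame.\<close>
    have fix_tail: "(\<forall>\<^sub>F i in sequentially. g (i, y) = (i, y)) \<or> (\<forall>\<^sub>F i in sequentially. g (i, y) \<noteq> (i, y))"
      if y: "y \<in> {1..n}" for y
    proof -
      obtain a b where ab: "\<And>i. g (a + i, y) = (b + i, y)" using tr[OF g y] by blast
      show ?thesis
      proof (cases "a = b")
        case True
        then have "\<forall>\<^sub>F i in sequentially. g (i, y) = (i, y)"
          using ab by (intro eventually_from[of _ a]) simp
        then show ?thesis ..
      next
        case False
        then have "\<forall>\<^sub>F i in sequentially. g (i, y) \<noteq> (i, y)"
          using ab by (intro eventually_from[of _ a]) simp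
        then show ?thesis ..
      qed
    qed
    have "admissible U"
      unfolding admissible_def
    proof (intro conjI allI)
      show "U \<subseteq> aperiodic" using adm by (auto simp: U_def admissible_def)
      show "q s \<in> U \<longleftrightarrow> s \<in> U" for s
        by (simp add: U_def admissibleD(3)[OF adm(1)] commutantD(2)[OF gc])
      show "tame U"
        unfolding tame_def
      proof
        fix y assume y: "y \<in> {1..n}"
        consider "\<forall>\<^sub>F i in sequentially. (i, y) \<in> T" "\<forall>\<^sub>F i in sequentially. g (i, y) = (i, y)"
          | "\<forall>\<^sub>F i in sequentially. (i, y) \<notin> T" | "\<forall>\<^sub>F i in sequentially. g (i, y) \<noteq> (i, y)"
          using adm(1) y fix_tail[OF y] unfolding admissible_def tame_def by blast
        then show "(\<forall>\<^sub>F i in sequentially. (i, y) \<in> U) \<or> (\<forall>\<^sub>F i in sequentially. (i, y) \<notin> U)"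
        proof cases
          case 1
          then have "\<forall>\<^sub>F i in sequentially. (i, y) \<in> U" by eventually_elim (simp add: U_def)
          then show ?thesis ..
        next
          case 2
          then have "\<forall>\<^sub>F i in sequentially. (i, y) \<notin> U" by eventually_elim (simp add: U_def)
          then show ?thesis ..
        next
          case 3
          then have "\<forall>\<^sub>F i in sequentially. (i, y) \<notin> U" by eventually_elim (simp add: U_def)
          then show ?thesis ..
        qed
      qed
    qed
    \<comment> \<open>Shift 0 means equal offsets, so g fixes a tail of the ray x, and x is an end
      of T.\<close>
    moreover have "U \<noteq> {}"
    proof -
      obtain a b where ab: "\<And>i. g (a + i, x) = (b + i, x)" using tr[OF g xn] by blast
      have "a = b" using shift_eq[of g, OF ab] 0 by simp
      moreover obtain N where "\<And>i. i \<ge> N \<Longrightarrow> (i, x) \<in> T"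
        using x by (auto simp: ends_def eventually_sequentially)
      ultimately have "(a + N, x) \<in> U" using ab by (simp add: U_def)
      then show ?thesis by blast
    qed
    ultimately have "U = T"
      using T unfolding component_def by (auto simp: U_def)
    then have "g s = s" for s
      using g unfolding supported_def U_def by blast
    then show ?thesis by auto
  qed
  have inj: "inj_on (shift x) (supported commutant T)"
  proof -
    interpret group_hom "perm_group (supported commutant T)" integer_group "shift x"
      using hom S.group_perm_group by (simp add: group_hom_def group_hom_axioms_def)
    show ?thesis
      using inj_on_one_iff ker by simp
  qed
  have q: "localize T q \<in> supported commutant T"
    by (rule localize_supported[OF block_admissible[OF adm(1)] q_commutant])
  \<comment> \<open>The restriction of q serves as an element of nonzero shift: it is not the
    identity, since q has no fixed point in T.\<close>
  have "shift x (localize T q) \<noteq> 0"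
  proof
    assume "shift x (localize T q) = 0"
    then have "localize T q = id" using ker[OF q] by simp
    moreover obtain s where s: "s \<in> T" using adm by blast
    ultimately have "q s = s" by (metis localize_def id_apply)
    then show False
      using s admissibleD(1)[OF adm(1)] aperiodicD by blast
  qed
  then show ?thesis
    using iso_integer_group[OF S.group_perm_group hom, of "localize T q"] inj q by simp
qed

lemma aperiodic_iso:
  "perm_group (supported commutant aperiodic) \<cong>
    product_group {1..card (Collect component)} (\<lambda>_. integer_group)"
proof -
  have "pairwise disjnt (Collect component)"
    using component_disjoint by (auto simp: pairwise_def disjnt_def)
  then have "perm_group (supported commutant aperiodic) \<cong>
      product_group (Collect component) (\<lambda>T. perm_group (supported commutant T))"
    using supported_Union_iso[OF finite_component] block_admissible
    unfolding Union_component by (auto simp: component_def)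
  also have "\<dots> \<cong> product_group (Collect component) (\<lambda>_. integer_group)"
    by (rule iso_product_groupI)
      (simp_all add: component_iso_integer perms.group_perm_group[OF perms_supported])
  also obtain b where "bij_betw b {1..card (Collect component)} (Collect component)"
    using ex_bij_betw_nat_finite_1[OF finite_component] by blast
  then have "product_group (Collect component) (\<lambda>_. integer_group) \<cong>
      product_group {1..card (Collect component)} (\<lambda>_. integer_group)"
    by (rule product_group_reindex)
  finally show ?thesis .
qed

section \<open>The parts of the periodic points\<close>

lemma comm_group_cyc: "comm_group (cyc n q)"
  by (subst cyc_eq, rule group.group_comm_groupI[OF Q.group_perm_group])
    (use powers_comm in simp_all)

text \<open>Equality of stabilisers replaces conjugacy, as Q is abelian.\<close>

definition part :: "nat \<times> nat \<Rightarrow> (nat \<times> nat) set" where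
  "part s = {t \<in> rays n - fixed. stab n q t = stab n q s}"

lemma stab_parts_eq: "stab_parts n q = part ` (rays n - fixed)"
proof -
  have "stab n q s \<subseteq> powers" for s
    by (auto simp: stab_eq)
  then have conj: "g <#\<^bsub>cyc n q\<^esub> stab n q s #>\<^bsub>cyc n q\<^esub> inv\<^bsub>cyc n q\<^esub> g = stab n q s"
    if "g \<in> powers" for g s
    using comm_group.conjugate_coset_eq[OF comm_group_cyc] that by blast
  have "(\<exists>g\<in>powers. stab n q t = g <#\<^bsub>cyc n q\<^esub> stab n q s #>\<^bsub>cyc n q\<^esub> inv\<^bsub>cyc n q\<^esub> g) \<longleftrightarrow>
      stab n q t = stab n q s" for s t
    using conj q_mem_powers by metis
  then show ?thesis
    unfolding stab_parts_def quotient_def part_def by auto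
qed

text \<open>A common description for both cases of the theorem: all parts if q has finite order, and
  the parts with nontrivial stabilisers otherwise.\<close>

definition parts :: "(nat \<times> nat) set set" where
  "parts = part ` periodic"

lemma periodic_mem_iff: "s \<in> periodic \<longleftrightarrow> s \<in> rays n - fixed \<and> (\<exists>j\<ge>1. q ^^ j \<in> stab n q s)"
  using pow_mem_powers unfolding periodic_def aperiodic_def stab_eq by blast

lemma part_periodic: "s \<in> periodic \<Longrightarrow> part s \<subseteq> periodic"
  unfolding part_def by (auto simp only: periodic_mem_iff)

lemma mem_part: "s \<in> periodic \<Longrightarrow> s \<in> part s"
  by (simp add: part_def periodic_mem_iff)

lemma partsE:
  assumes "P \<in> parts" "s \<in> P"
  shows "s \<in> periodic" "P = part s"
proof -
  obtain t where t: "t \<in> periodic" "P = part t"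
    using assms(1) by (auto simp: parts_def)
  then show "s \<in> periodic" using part_periodic assms(2) by blast
  show "P = part s" using assms(2) t(2) by (auto simp: part_def)
qed

lemma Union_parts: "\<Union>parts = periodic"
  using part_periodic mem_part by (auto simp: parts_def)

lemma finite_part: "P \<in> parts \<Longrightarrow> finite P"
  using finite_periodic Union_parts by (metis Union_upper finite_subset)

lemma finite_parts: "finite parts"
  using finite_periodic by (simp add: parts_def)

lemma parts_disjoint: "pairwise disjnt parts"
  using partsE(2) unfolding pairwise_def disjnt_def by blast

lemma block_part:
  assumes "P \<in> parts"
  shows "block commutant P"
proof (rule block_commutantI)
  show "P \<subseteq> rays n"
    using partsE(1)[OF assms] rays_decomp(1) by blast
  show "tame P"
    by (rule tame_finite[OF finite_part[OF assms]])
  fix g s assume g: "g \<in> commutant" and s: "s \<in> P"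
  then have "s \<in> part s" using partsE(2)[OF assms s] by simp
  then have "g s \<in> part s"
    using commutant_apply_iff(1,2)[OF g] stab_commutant[OF g] unfolding part_def by blast
  then show "g s \<in> P" using partsE(2)[OF assms s] by simp
qed

text \<open>On a finite P the condition on tails disappears, and commuting with the powers of q on P
  implies commuting with q everywhere, since off P the permutation is the identity.\<close>

lemma supported_part:
  assumes "P \<in> parts"
  shows "supported commutant P = {g. g permutes P \<and> (\<forall>u\<in>powers. \<forall>p\<in>P. g (u p) = u (g p))}"
proof (intro equalityI subsetI)
  fix g assume g: "g \<in> supported commutant P"
  then have gc: "g \<in> commutant" "\<And>s. s \<notin> P \<Longrightarrow> g s = s"
    unfolding supported_def by blast+
  have "g permutes P"
    by (rule permutes_superset[OF commutantD(1)[OF gc(1)]]) (use gc(2) in blast)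
  then show "g \<in> {g. g permutes P \<and> (\<forall>u\<in>powers. \<forall>p\<in>P. g (u p) = u (g p))}"
    using powers_apply_commutant[OF gc(1)] by blast
next
  have P: "P \<subseteq> rays n"
    using partsE(1)[OF assms] rays_decomp(1) by blast
  fix g assume "g \<in> {g. g permutes P \<and> (\<forall>u\<in>powers. \<forall>p\<in>P. g (u p) = u (g p))}"
  then have g: "g permutes P" "\<And>p. p \<in> P \<Longrightarrow> g (q p) = q (g p)"
    using q_mem_powers by blast+
  have "g \<in> supported (houghton_perms n) P"
    using g(1) houghton_perms_finite[OF P finite_part[OF assms]] by simp
  moreover have "g (q s) = q (g s)" for s
  proof (cases "s \<in> P")
    case False
    then have "q s \<notin> P"
      using block_apply_iff[OF block_part[OF assms] q_commutant] by simp
    then show ?thesis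
      using False permutes_not_in[OF g(1)] by simp
  qed (rule g(2))
  ultimately show "g \<in> supported commutant P"
    by (auto simp: supported_def commutant_def)
qed

lemma uniform_action_part:
  assumes P: "P \<in> parts" and s: "s \<in> P"
  shows "uniform_action powers P (stab n q s)"
proof
  show "u p \<in> P" if "u \<in> powers" "p \<in> P" for u p
    using block_apply_iff[OF block_part[OF P]] powers_subset that by blast
  show "stab n q s = {u \<in> powers. u p = p}" if "p \<in> P" for p
    using that partsE(2)[OF P s] unfolding part_def by (auto simp: stab_eq)
qed (use powers_comm finite_part[OF P] s in auto)

lemma part_iso:
  assumes P: "P \<in> parts" and s: "s \<in> P"
  shows "perm_group (supported commutant P) \<cong> part_group n q P s"
proof -
  interpret U: uniform_action powers P "stab n q s"
    by (rule uniform_action_part[OF assms])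
  show ?thesis
    using U.commutant_iso_wreath
    by (simp only: supported_part[OF P] part_group_def cyc_eq[symmetric])
qed

lemma subgroup_index_part_dvd:
  assumes P: "P \<in> parts" and s: "s \<in> P"
  shows "subgroup_index (cyc n q) (stab n q s) dvd card P"
proof -
  interpret U: uniform_action powers P "stab n q s"
    by (rule uniform_action_part[OF assms])
  show ?thesis
    using U.subgroup_index_dvd by (simp only: cyc_eq[symmetric])
qed

lemma periodic_iso:
  assumes "\<And>P. P \<in> parts \<Longrightarrow> s P \<in> P"
  shows "perm_group (supported commutant periodic) \<cong> product_group parts (\<lambda>P. part_group n q P (s P))"
proof -
  have "perm_group (supported commutant periodic) \<cong>
      product_group parts (\<lambda>P. perm_group (supported commutant P))"
    using supported_Union_iso[OF finite_parts block_part parts_disjoint] by (simp add: Union_parts)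
  also have "\<dots> \<cong> product_group parts (\<lambda>P. part_group n q P (s P))"
    by (rule product_group_iso)
      (simp_all add: part_iso assms perms.group_perm_group[OF perms_supported])
  finally show ?thesis .
qed

lemma stab_parts_finite:
  assumes "finite powers"
  shows "stab_parts n q = parts"
  using aperiodic_empty[OF assms] by (simp add: stab_parts_eq parts_def periodic_def)

text \<open>Off the fixed points no stabiliser is all of Q, and for q of infinite order it is
  trivial exactly at the aperiodic points; what remains is \<open>periodic\<close>.\<close>

lemma nontrivial_stab_parts_infinite:
  assumes "infinite powers"
  shows "nontrivial_stab_parts n q = parts"
proof -
  have trivial: "stab n q s = {id} \<longleftrightarrow> s \<in> aperiodic" if s: "s \<in> rays n - fixed" for s
  proof
    assume "stab n q s = {id}"
    \<comment> \<open>Infinite order enters here: a positive iterate in the stabiliser would be a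
      nontrivial element of it.\<close>
    moreover have "q ^^ j \<noteq> id" if "j \<ge> 1" for j
      using assms that unfolding finite_powers_iff by blast
    ultimately show "s \<in> aperiodic"
      using s periodic_mem_iff unfolding periodic_def by blast
  next
    assume "s \<in> aperiodic"
    then have j0: "j = 0" if "(q ^^ j) s = s" for j
      using that unfolding aperiodic_def by (metis (mono_tags, lifting) Suc_leI mem_Collect_eq neq0_conv One_nat_def)
    have "u = id" if u: "u \<in> powers" "u s = s" for u
    proof -
      obtain j where j: "u = q ^^ j \<or> u = inv' (q ^^ j)"
        using u(1) unfolding powers_eq by blast
      then have "(q ^^ j) s = s"
        using u(2) bij_inv_eq_iff[OF bij_pow] by metis
      then have "j = 0" by (rule j0)
      with j show ?thesis by auto
    qed
    then show "stab n q s = {id}"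
      using Q.id_mem unfolding stab_eq by auto
  qed
  have proper: "stab n q s \<noteq> powers" if "s \<in> rays n - fixed" for s
    using that q_mem_powers unfolding stab_eq fixed_eq by blast
  show ?thesis
  proof (intro equalityI subsetI)
    fix P assume "P \<in> nontrivial_stab_parts n q"
    then have P: "P \<in> stab_parts n q" "\<And>s. s \<in> P \<Longrightarrow> stab n q s \<noteq> {id}"
      unfolding nontrivial_stab_parts_def cyc_simps by blast+
    then obtain s where s: "s \<in> rays n - fixed" "P = part s"
      unfolding stab_parts_eq by blast
    then have "s \<in> P" by (simp add: part_def)
    then have "s \<notin> aperiodic" using P(2) trivial[OF s(1)] by blast
    then show "P \<in> parts" using s by (auto simp: parts_def periodic_def)
  next
    fix P assume P: "P \<in> parts"
    have "P \<in> stab_parts n q"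
      using P unfolding parts_def stab_parts_eq periodic_def by blast
    moreover have "stab n q s \<noteq> {id} \<and> stab n q s \<noteq> powers" if "s \<in> P" for s
      using partsE(1)[OF P that] trivial[of s] proper[of s] unfolding periodic_def by blast
    ultimately show "P \<in> nontrivial_stab_parts n q"
      unfolding nontrivial_stab_parts_def cyc_simps by blast
  qed
qed

section \<open>The centraliser\<close>

lemma commutant_iso_finite:
  assumes "finite powers"
  shows "perm_group commutant \<cong>
    perm_group (supported commutant fixed) \<times>\<times> perm_group (supported commutant periodic)"
proof -
  have rays: "rays n = fixed \<union> periodic" and disj: "fixed \<inter> periodic = {}"
    using rays_decomp aperiodic_empty[OF assms] by blast+
  show ?thesis
    using supported_Un_iso[OF block_fixed block_periodic disj] unfolding rays[symmetric] supported_rays .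
qed

text \<open>Every coset is represented by the restriction of its elements to
  \<open>periodic\<close>, and a finite set has only finitely many permutations.\<close>

lemma finite_rcosets_fixed:
  assumes "finite powers"
  shows "finite (rcosets\<^bsub>perm_group commutant\<^esub> (supported commutant fixed))"
proof -
  interpret group "perm_group commutant" by (rule group_perm_group)
  let ?K = "supported commutant fixed"
  have rays: "rays n = fixed \<union> periodic" and disj: "fixed \<inter> periodic = {}"
    using rays_decomp aperiodic_empty[OF assms] by blast+
  have K: "subgroup ?K (perm_group commutant)"
    by (rule subgroup_perm_group[OF perms_supported]) (auto simp: supported_def)
  have "rcosets\<^bsub>perm_group commutant\<^esub> ?K \<subseteq>
      (\<lambda>g. ?K #>\<^bsub>perm_group commutant\<^esub> g) ` supported commutant periodic"
  proof
    fix c assume "c \<in> rcosets\<^bsub>perm_group commutant\<^esub> ?K"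
    then obtain g where g: "g \<in> commutant" "c = ?K #>\<^bsub>perm_group commutant\<^esub> g"
      by (auto simp: RCOSETS_def)
    let ?f = "localize fixed g" and ?p = "localize periodic g"
    have fp: "?f \<in> supported commutant fixed" "?p \<in> supported commutant periodic"
      using localize_supported block_fixed block_periodic g(1) by blast+
    then have mem: "?f \<in> commutant" "?p \<in> commutant" by (auto simp: supported_def)
    have "g s = ?f (?p s)" for s
    proof -
      consider "s \<in> fixed" "s \<notin> periodic" | "s \<in> periodic" "s \<notin> fixed" | "s \<notin> rays n"
        using rays disj by blast
      then show ?thesis
      proof cases
        case 2
        then have "g s \<notin> fixed" using commutant_apply_iff(2)[OF g(1)] by simp
        then show ?thesis using 2 by (simp add: localize_def)
      next
        case 3
        then show ?thesis
          using permutes_not_in[OF commutantD(1)[OF g(1)]] by (simp add: localize_def)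
      qed (simp add: localize_def)
    qed
    then have "g = ?f \<circ> ?p" by auto
    then have "c = ?K #>\<^bsub>perm_group commutant\<^esub> ?f #>\<^bsub>perm_group commutant\<^esub> ?p"
      using g(2) coset_mult_assoc[OF subgroup.subset[OF K], of ?f ?p] mem by simp
    also have "?K #>\<^bsub>perm_group commutant\<^esub> ?f = ?K"
      using coset_join2[OF _ K fp(1)] mem by simp
    finally show "c \<in> (\<lambda>g. ?K #>\<^bsub>perm_group commutant\<^esub> g) ` supported commutant periodic"
      using fp(2) by blast
  qed
  moreover have "finite (supported commutant periodic)"
  proof (rule finite_subset[OF _ finite_permutations[OF finite_periodic]])
    show "supported commutant periodic \<subseteq> {p. p permutes periodic}"
    proof
      fix g assume "g \<in> supported commutant periodic"
      then have "g permutes rays n" "\<And>s. s \<notin> periodic \<Longrightarrow> g s = s"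
        using commutantD(1) unfolding supported_def by blast+
      then show "g \<in> {p. p permutes periodic}"
        using permutes_superset by blast
    qed
  qed
  ultimately show ?thesis
    using finite_subset by blast
qed

lemma houghton_on_fixed_iso:
  assumes "finite powers" "n > 0"
  shows "houghton_on n fixed \<cong> houghton n"
proof -
  have "\<forall>\<^sub>F i in sequentially. (i, x) \<in> fixed" if "x \<in> {1..n}" for x
    using ends_aperiodic_iff[OF that] aperiodic_empty[OF assms(1)] by (simp add: ends_empty)
  then have "perm_group (supported (houghton_perms n) fixed) \<cong> houghton (card {1..n})"
    using assms(2) rays_decomp(1) by (intro houghton_perms_supported_iso) auto
  then show ?thesis
    by (simp add: houghton_on_fixed supported_fixed)
qed

lemma commutant_iso_infinite:
  "perm_group commutant \<cong> perm_group (supported commutant fixed) \<times>\<times>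
    perm_group (supported commutant aperiodic) \<times>\<times> perm_group (supported commutant periodic)"
proof -
  have rest: "aperiodic \<union> periodic = rays n - fixed"
    using rays_decomp(1,2) by blast
  have "tame (rays n)"
    by (simp add: tame_def mem_rays_iff)
  then have block: "block commutant (aperiodic \<union> periodic)"
    unfolding rest
    by (intro block_commutantI tame_Diff[OF _ tame_fixed])
      (use commutant_apply_iff(1,2) in blast)+
  have "perm_group commutant \<cong> perm_group (supported commutant fixed) \<times>\<times>
      perm_group (supported commutant (aperiodic \<union> periodic))"
    using supported_Un_iso[OF block_fixed block rays_decomp(2)]
    unfolding rays_decomp(1)[symmetric] supported_rays .
  also have "\<dots> \<cong> perm_group (supported commutant fixed) \<times>\<times>
    perm_group (supported commutant aperiodic) \<times>\<times> perm_group (supported commutant periodic)"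
    by (rule group.DirProd_iso_trans[OF perms.group_perm_group[OF perms_supported] iso_refl
          supported_Un_iso[OF block_aperiodic block_periodic rays_decomp(3)]])
  finally show ?thesis .
qed

text \<open>A ray without an aperiodic tail has a fixed tail, which gives the value of k. If there
  is no such ray, \<open>fixed\<close> is finite and m is its size.\<close>

lemma fixed_iso:
  obtains k where "k = n - card (ends aperiodic)" "perm_group (supported commutant fixed) \<cong> houghton k"
  | m where "card (ends aperiodic) = n" "perm_group (supported commutant fixed) \<cong> sym_group m"
proof -
  define R where "R = {1..n} - ends aperiodic"
  have fr: "fixed \<subseteq> rays n" using rays_decomp(1) by blast
  have ends: "ends aperiodic \<subseteq> {1..n}" by (auto simp: ends_def)
  have out: "\<forall>\<^sub>F i in sequentially. (i, x) \<notin> fixed" if "x \<in> ends aperiodic" for x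
  proof -
    have "\<forall>\<^sub>F i in sequentially. (i, x) \<in> aperiodic" using that by (simp add: ends_def)
    then show ?thesis by (rule eventually_mono) (use rays_decomp(2) in blast)
  qed
  show thesis
  proof (cases "R = {}")
    case True
    then have eq: "ends aperiodic = {1..n}" using ends by (auto simp: R_def)
    have "finite fixed"
      by (rule finite_if_eventually_notin[OF fr]) (use out eq in blast)
    then have "perm_group (supported commutant fixed) \<cong> sym_group (card fixed)"
      using permutes_iso_sym_group houghton_perms_finite[OF fr] by (simp add: supported_fixed)
    then show thesis using that(2) eq by simp
  next
    case False
    have "perm_group (supported (houghton_perms n) fixed) \<cong> houghton (card R)"
    proof (rule houghton_perms_supported_iso[OF fr _ False])
      show "\<forall>\<^sub>F i in sequentially. (i, x) \<in> fixed" if "x \<in> R" for x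
        using that ends_aperiodic_iff[of x] unfolding R_def by blast
      show "\<forall>\<^sub>F i in sequentially. (i, x) \<notin> fixed" if "x \<in> {1..n} - R" for x
        using that out unfolding R_def by blast
    qed (simp add: R_def)
    moreover have "card R = n - card (ends aperiodic)"
      using card_Diff_subset[OF finite_ends ends] by (simp add: R_def)
    ultimately show thesis
      using that(1)[of "card R"] by (simp add: supported_fixed)
  qed
qed

end

theorem mainTheorem16:
  fixes n :: nat
    and q :: "nat \<times> nat \<Rightarrow> nat \<times> nat"
    and s :: "(nat \<times> nat) set \<Rightarrow> nat \<times> nat"
  assumes n: "n > 1"
    and q: "q \<in> carrier (houghton n)"
    and s: "\<And>P. P \<in> stab_parts n q \<Longrightarrow> s P \<in> P"
  shows
    "(finite (carrier (cyc n q)) \<longrightarrow>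
        finite (stab_parts n q) \<and>
        (\<forall>P \<in> stab_parts n q.
           finite P \<and> subgroup_index (cyc n q) (stab n q (s P)) dvd card P) \<and>
        centralizer (houghton n) q \<cong>
          houghton_on n (fixed_points n q) \<times>\<times>
          product_group (stab_parts n q) (\<lambda>P. part_group n q P (s P)) \<and>
        houghton_on n (fixed_points n q) \<cong> houghton n \<and>
        (\<exists>K. subgroup K (centralizer (houghton n) q) \<and>
             finite (rcosets\<^bsub>centralizer (houghton n) q\<^esub> K) \<and>
             houghton n \<cong> (centralizer (houghton n) q)\<lparr>carrier := K\<rparr>)) \<and>
     (infinite (carrier (cyc n q)) \<longrightarrow>
        finite (nontrivial_stab_parts n q) \<and>
        (\<forall>P \<in> nontrivial_stab_parts n q.
           finite P \<and> subgroup_index (cyc n q) (stab n q (s P)) dvd card P) \<and>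
        ((\<exists>k r. k \<le> n - 2 \<and> 1 \<le> r \<and> r \<le> (n - k) div 2 \<and>
            centralizer (houghton n) q \<cong>
              houghton k \<times>\<times> product_group {1..r} (\<lambda>_. integer_group) \<times>\<times>
              product_group (nontrivial_stab_parts n q) (\<lambda>P. part_group n q P (s P))) \<or>
         (\<exists>m r. 1 \<le> r \<and> r \<le> n div 2 \<and>
            centralizer (houghton n) q \<cong>
              sym_group m \<times>\<times> product_group {1..r} (\<lambda>_. integer_group) \<times>\<times>
              product_group (nontrivial_stab_parts n q) (\<lambda>P. part_group n q P (s P)))))"
proof -
  interpret houghton_element n q
    by unfold_locales (use q in \<open>simp add: houghton_eq\<close>)
  have group_supported: "group (perm_group (supported commutant T))" for T
    by (rule perms.group_perm_group[OF perms_supported])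
  have sP: "s P \<in> P" if "P \<in> parts" for P
    using s that unfolding stab_parts_eq parts_def periodic_def by blast
  have per: "perm_group (supported commutant periodic) \<cong>
      product_group parts (\<lambda>P. part_group n q P (s P))"
    using sP by (rule periodic_iso)
  have dvd: "\<forall>P\<in>parts. finite P \<and> subgroup_index (cyc n q) (stab n q (s P)) dvd card P"
    using finite_part subgroup_index_part_dvd sP by blast
  show ?thesis
  proof (intro conjI impI)
    assume fin: "finite powers"
    note parts = stab_parts_finite[OF fin]
    show "finite (stab_parts n q)"
      by (simp add: parts finite_parts)
    show "\<forall>P\<in>stab_parts n q. finite P \<and> subgroup_index (cyc n q) (stab n q (s P)) dvd card P"
      using dvd by (simp only: parts)
    show "centralizer (houghton n) q \<cong> houghton_on n fixed \<times>\<times>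
        product_group (stab_parts n q) (\<lambda>P. part_group n q P (s P))"
      unfolding centralizer_eq houghton_on_fixed parts
      using commutant_iso_finite[OF fin] group.DirProd_iso_trans[OF group_supported iso_refl per]
      by (rule iso_trans)
    show on: "houghton_on n fixed \<cong> houghton n"
      using fin n by (intro houghton_on_fixed_iso) simp_all
    show "\<exists>K. subgroup K (centralizer (houghton n) q) \<and>
        finite (rcosets\<^bsub>centralizer (houghton n) q\<^esub> K) \<and>
        houghton n \<cong> (centralizer (houghton n) q)\<lparr>carrier := K\<rparr>"
    proof (intro exI conjI)
      \<comment> \<open>The witness is the direct factor supported on the fixed points, a copy of
        \<open>houghton n\<close>.\<close>
      show "subgroup (supported commutant fixed) (centralizer (houghton n) q)"
        unfolding centralizer_eq
        by (rule subgroup_perm_group[OF perms_supported]) (auto simp: supported_def)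
      show "finite (rcosets\<^bsub>centralizer (houghton n) q\<^esub> (supported commutant fixed))"
        unfolding centralizer_eq by (rule finite_rcosets_fixed[OF fin])
      have "group (houghton_on n fixed)"
        unfolding houghton_on_fixed by (rule group_supported)
      then have "houghton n \<cong> houghton_on n fixed"
        using on by (rule group.iso_sym)
      then show "houghton n \<cong> (centralizer (houghton n) q)\<lparr>carrier := supported commutant fixed\<rparr>"
        by (simp add: centralizer_eq houghton_on_fixed)
    qed
  next
    assume inf: "infinite powers"
    note parts = nontrivial_stab_parts_infinite[OF inf]
    show "finite (nontrivial_stab_parts n q)"
      by (simp add: parts finite_parts)
    show "\<forall>P\<in>nontrivial_stab_parts n q. finite P \<and>
        subgroup_index (cyc n q) (stab n q (s P)) dvd card P"
      using dvd by (simp only: parts)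
    define r where "r = card (Collect component)"
    \<comment> \<open>G ranges over permutation monoids on any type, because
      \<open>houghton k\<close> and \<open>sym_group m\<close> act on points of different
      types.\<close>
    have iso: "centralizer (houghton n) q \<cong> G \<times>\<times> product_group {1..r} (\<lambda>_. integer_group) \<times>\<times>
        product_group (nontrivial_stab_parts n q) (\<lambda>P. part_group n q P (s P))"
      if "perm_group (supported commutant fixed) \<cong> G" for G :: "('a \<Rightarrow> 'a) monoid"
      unfolding centralizer_eq parts r_def
      by (rule iso_trans[OF commutant_iso_infinite group.DirProd_iso_trans[OF group_supported that
            group.DirProd_iso_trans[OF group_supported aperiodic_iso per]]])
    have two: "card (ends aperiodic) \<ge> 2"
      using two_ends[OF admissible_aperiodic aperiodic_nonempty[OF inf]] .
    have r1: "r \<ge> 1"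
    proof -
      have "Collect component \<noteq> {}"
        using Union_component aperiodic_nonempty[OF inf] by blast
      then have "r \<noteq> 0" using finite_component by (simp add: r_def)
      then show ?thesis by simp
    qed
    have r2: "2 * r \<le> card (ends aperiodic)"
      using card_component by (simp add: r_def)
    have "card (ends aperiodic) \<le> card {1..n}"
      by (rule card_mono) (auto simp: ends_def)
    then have le: "card (ends aperiodic) \<le> n" by simp
    show "(\<exists>k r. k \<le> n - 2 \<and> 1 \<le> r \<and> r \<le> (n - k) div 2 \<and>
            centralizer (houghton n) q \<cong>
              houghton k \<times>\<times> product_group {1..r} (\<lambda>_. integer_group) \<times>\<times>
              product_group (nontrivial_stab_parts n q) (\<lambda>P. part_group n q P (s P))) \<or>
         (\<exists>m r. 1 \<le> r \<and> r \<le> n div 2 \<and>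
            centralizer (houghton n) q \<cong>
              sym_group m \<times>\<times> product_group {1..r} (\<lambda>_. integer_group) \<times>\<times>
              product_group (nontrivial_stab_parts n q) (\<lambda>P. part_group n q P (s P)))"
    proof (cases rule: fixed_iso)
      case (1 k)
      \<comment> \<open>Here n - k is the number of ends of \<open>aperiodic\<close>, which is at
        least 2 and at least 2 * r.\<close>
      have "k \<le> n - 2" "r \<le> (n - k) div 2"
        using 1(1) two r2 le by linarith+
      then show ?thesis
        using r1 iso[OF 1(2)] by blast
    next
      case (2 m)
      have "r \<le> n div 2"
        using r2 2(1) by linarith
      then show ?thesis
        using r1 iso[OF 2(2)] by blast
    qed
  qed
qed

end
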